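(* There are infinitely many (pairwise non-isomorphic) $3$-extendable non-bipartite graphs which can be embedded in the Klein bottle.
   Context: All graphs are finite and simple. An embedding of a graph on a surface means a cellular ($2$-cell) embedding: a drawing of the graph on the surface in which edges cross only at vertices and every face is homeomorphic to an open disk. The Klein bottle is the non-orientable closed surface $N_2$ obtained from the sphere by adding two cross-caps. A $k$-matching is a set of $k$ pairwise disjoint edges. A graph $G$ is $k$-extendable if it has at least $2k+2$ vertices, it has a perfect matching, and every $k$-matching of $G$ is contained in a perfect matching of $G$. *)

theory Defs
  imports "HOL-Analysis.Analysis"
begin

section \<open>Finite simple graphs and matchings\<close>

text \<open>A graph is a pair (vertex set, edge set), an edge being a two-element set of vertices.\<close>

type_synonym 'a graph = "'a set \<times> 'a set set"

abbreviation verts :: "'a graph \<Rightarrow> 'a set" where "verts G \<equiv> fst G"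

abbreviation edges :: "'a graph \<Rightarrow> 'a set set" where "edges G \<equiv> snd G"

definition finite_simple_graph :: "'a graph \<Rightarrow> bool" where
  "finite_simple_graph G \<longleftrightarrow>
     finite (verts G) \<and> (\<forall>e\<in>edges G. e \<subseteq> verts G \<and> card e = 2)"

definition graph_isomorphic :: "'a graph \<Rightarrow> 'b graph \<Rightarrow> bool" where
  "graph_isomorphic G H \<longleftrightarrow>
     (\<exists>f. bij_betw f (verts G) (verts H) \<and>
       (\<forall>u\<in>verts G. \<forall>v\<in>verts G. {u, v} \<in> edges G \<longleftrightarrow> {f u, f v} \<in> edges H))"

definition bipartite :: "'a graph \<Rightarrow> bool" where
  "bipartite G \<longleftrightarrow>
     (\<exists>A B. A \<union> B = verts G \<and> A \<inter> B = {} \<and>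
       (\<forall>e\<in>edges G. \<exists>a\<in>A. \<exists>b\<in>B. e = {a, b}))"

definition matching :: "'a graph \<Rightarrow> 'a set set \<Rightarrow> bool" where
  "matching G M \<longleftrightarrow> M \<subseteq> edges G \<and> pairwise disjnt M"

definition k_matching :: "nat \<Rightarrow> 'a graph \<Rightarrow> 'a set set \<Rightarrow> bool" where
  "k_matching k G M \<longleftrightarrow> matching G M \<and> finite M \<and> card M = k"

definition perfect_matching :: "'a graph \<Rightarrow> 'a set set \<Rightarrow> bool" where
  "perfect_matching G M \<longleftrightarrow> matching G M \<and> \<Union>M = verts G"

definition k_extendable :: "nat \<Rightarrow> 'a graph \<Rightarrow> bool" where
  "k_extendable k G \<longleftrightarrow>
     card (verts G) \<ge> 2 * k + 2 \<and>
     (\<exists>P. perfect_matching G P) \<and>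
     (\<forall>M. k_matching k G M \<longrightarrow> (\<exists>P. perfect_matching G P \<and> M \<subseteq> P))"


section \<open>Quotient spaces\<close>

definition quotient_topology :: "'a topology \<Rightarrow> ('a \<times> 'a) set \<Rightarrow> 'a set topology" where
  "quotient_topology X r = topology (\<lambda>U. U \<subseteq> topspace X // r \<and> openin X (\<Union>U))"

lemma openin_quotient_topology:
  assumes "equiv (topspace X) r"
  shows "openin (quotient_topology X r) U \<longleftrightarrow> U \<subseteq> topspace X // r \<and> openin X (\<Union>U)"
proof -
  have Int: "\<Union>(S \<inter> T) = \<Union>S \<inter> \<Union>T"
    if "S \<subseteq> topspace X // r" "T \<subseteq> topspace X // r" for S T
    using that quotient_disj [OF assms] by blast
  have "istopology (\<lambda>U. U \<subseteq> topspace X // r \<and> openin X (\<Union>U))"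
    unfolding istopology_def
  proof (intro conjI allI impI)
    fix S T
    assume S: "S \<subseteq> topspace X // r \<and> openin X (\<Union>S)"
      and T: "T \<subseteq> topspace X // r \<and> openin X (\<Union>T)"
    show "S \<inter> T \<subseteq> topspace X // r" using S by blast
    show "openin X (\<Union>(S \<inter> T))" using S T by (simp add: Int openin_Int)
  next
    fix K
    assume K: "\<forall>U\<in>K. U \<subseteq> topspace X // r \<and> openin X (\<Union>U)"
    show "\<Union>K \<subseteq> topspace X // r" using K by blast
    have "openin X (\<Union>(Union ` K))" using K by (intro openin_Union) auto
    moreover have "\<Union>(\<Union>K) = \<Union>(Union ` K)" by blast
    ultimately show "openin X (\<Union>(\<Union>K))" by metis
  qed
  then show ?thesis
    by (simp add: quotient_topology_def topology_inverse')
qed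

lemma topspace_quotient_topology:
  assumes "equiv (topspace X) r"
  shows "topspace (quotient_topology X r) = topspace X // r"
proof -
  have "openin (quotient_topology X r) (topspace X // r)"
    by (simp add: openin_quotient_topology [OF assms] Union_quotient [OF assms])
  then show ?thesis
    by (metis assms openin_quotient_topology openin_subset openin_topspace subset_antisym)
qed

lemma quotient_map_quotient_topology:
  assumes "equiv (topspace X) r"
  shows "quotient_map X (quotient_topology X r) (\<lambda>x. r `` {x})"
proof -
  have "{x \<in> topspace X. r `` {x} \<in> U} = \<Union>U" if "U \<subseteq> topspace X // r" for U
  proof
    show "{x \<in> topspace X. r `` {x} \<in> U} \<subseteq> \<Union>U"
      using equiv_class_self [OF assms] by blast
    show "\<Union>U \<subseteq> {x \<in> topspace X. r `` {x} \<in> U}"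
    proof
      fix x assume "x \<in> \<Union>U"
      then obtain C where C: "C \<in> U" "x \<in> C" by blast
      with that have "C \<in> topspace X // r" by blast
      then obtain y where y: "y \<in> topspace X" "C = r `` {y}" by (rule quotientE)
      with C have "(y, x) \<in> r" by simp
      then have "r `` {x} = C" "x \<in> topspace X"
        using equiv_class_eq [OF assms] y assms by (auto simp: equiv_def refl_on_def)
      with C show "x \<in> {x \<in> topspace X. r `` {x} \<in> U}" by simp
    qed
  qed
  then show ?thesis
    by (auto simp: quotient_map_def topspace_quotient_topology [OF assms]
        openin_quotient_topology [OF assms] quotient_def)
qed


section \<open>The Klein bottle\<close>

text \<open>The unit sphere of \<open>\<complex> \<times> \<real> = \<real>\<^sup>3\<close>, with the two open polar caps
  \<open>\<bar>t\<bar> > 1/2\<close> removed. Adding a cross-cap in place of a removed cap means identifying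
  antipodal points \<open>(z, t)\<close>, \<open>(-z, t)\<close> of its boundary circle.\<close>

definition punctured_sphere :: "(complex \<times> real) set" where
  "punctured_sphere = {(z, t). (z, t) \<in> sphere 0 1 \<and> \<bar>t\<bar> \<le> 1/2}"

definition crosscap_rel :: "((complex \<times> real) \<times> (complex \<times> real)) set" where
  "crosscap_rel =
     {((z, t), (w, s)). (z, t) \<in> punctured_sphere \<and> (w, s) \<in> punctured_sphere \<and>
        t = s \<and> (w = z \<or> \<bar>t\<bar> = 1/2 \<and> w = - z)}"

definition klein_bottle :: "(complex \<times> real) set topology" where
  "klein_bottle = quotient_topology (top_of_set punctured_sphere) crosscap_rel"

lemma equiv_crosscap_rel: "equiv punctured_sphere crosscap_rel"
  by (rule equivI) (auto simp: crosscap_rel_def refl_on_def sym_def trans_def)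

lemma topspace_klein_bottle: "topspace klein_bottle = punctured_sphere // crosscap_rel"
  by (simp add: klein_bottle_def topspace_quotient_topology equiv_crosscap_rel)


section \<open>Cellular embeddings\<close>

text \<open>A drawing places vertices at points by \<open>p\<close> and represents every edge \<open>e\<close> by the simple arc
  \<open>\<gamma> e\<close>, parametrised over \<open>{0..1}\<close>. The direction of the parametrisation is immaterial.\<close>

definition drawing ::
  "'b topology \<Rightarrow> 'a graph \<Rightarrow> ('a \<Rightarrow> 'b) \<Rightarrow> ('a set \<Rightarrow> real \<Rightarrow> 'b) \<Rightarrow> bool" where
  "drawing X G p \<gamma> \<longleftrightarrow>
     p ` verts G \<subseteq> topspace X \<and> inj_on p (verts G) \<and>
     (\<forall>e\<in>edges G.
        pathin X (\<gamma> e) \<and> inj_on (\<gamma> e) {0..1} \<and> {\<gamma> e 0, \<gamma> e 1} = p ` e \<and>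
        \<gamma> e ` {0<..<1} \<inter> p ` verts G = {}) \<and>
     (\<forall>e\<in>edges G. \<forall>f\<in>edges G. e \<noteq> f \<longrightarrow> \<gamma> e ` {0<..<1} \<inter> \<gamma> f ` {0<..<1} = {})"

definition drawing_image ::
  "'a graph \<Rightarrow> ('a \<Rightarrow> 'b) \<Rightarrow> ('a set \<Rightarrow> real \<Rightarrow> 'b) \<Rightarrow> 'b set" where
  "drawing_image G p \<gamma> = p ` verts G \<union> (\<Union>e\<in>edges G. \<gamma> e ` {0..1})"

definition faces ::
  "'b topology \<Rightarrow> 'a graph \<Rightarrow> ('a \<Rightarrow> 'b) \<Rightarrow> ('a set \<Rightarrow> real \<Rightarrow> 'b) \<Rightarrow> 'b set set" where
  "faces X G p \<gamma> =
     connected_components_of (subtopology X (topspace X - drawing_image G p \<gamma>))"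

definition cellular_embedding ::
  "'b topology \<Rightarrow> 'a graph \<Rightarrow> ('a \<Rightarrow> 'b) \<Rightarrow> ('a set \<Rightarrow> real \<Rightarrow> 'b) \<Rightarrow> bool" where
  "cellular_embedding X G p \<gamma> \<longleftrightarrow>
     drawing X G p \<gamma> \<and>
     (\<forall>F\<in>faces X G p \<gamma>.
        subtopology X F homeomorphic_space top_of_set (ball (0::complex) 1))"

definition embeddable_in :: "'a graph \<Rightarrow> 'b topology \<Rightarrow> bool" where
  "embeddable_in G X \<longleftrightarrow> (\<exists>p \<gamma>. cellular_embedding X G p \<gamma>)"

end

theory Submission
  imports Defs "HOL-Library.Code_Binary_Nat"
begin

text \<open>The graphs are pentagonal prisms closed up with a twist: a pentagon moves along a cycle of \<open>k\<close> points
  and returns reflected. Every pentagon is an odd cycle, so the graph is not bipartite. It is the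
  quotient of the square grid by the translation by \<open>5\<close> in one direction and a glide reflection by \<open>k\<close> in the
  other one. This group has the Klein bottle as its quotient of the plane, and the \<open>5 * k\<close> squares
  of the grid become the faces (\<open>embeddable_by_grid\<close>, \<open>klein_bottle_homeomorphic\<close>).

  The graph is 3-extendable for every even \<open>k \<ge> 8\<close>, by induction in steps of two. In a prism with at least
  ten slices (copies of the pentagon), the three given edges leave two consecutive slices untouched (\<open>two_free_slices\<close>). The edges
  form a matching of the prism without these slices and lie in a perfect matching there. Putting the
  two slices back, each crossing of the gap becomes two crossings, one into each new slice, and the remaining
  vertices of the new slices are matched in pairs (\<open>extends_insert_slices\<close>). The induction starts
  with eight slices, since with three blocks of at most two touched slices the remaining ones can be isolated
  as long as there are no more than nine slices. The case of eight slices is a finite verification: by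
  rotation, one of the three edges may be taken from a list of six, and for each of the six a list of fewer than fifty
  perfect matchings through it takes care of any two further edges (\<open>certifies_extends\<close>).\<close>


section \<open>Perfect matchings that extend a matching\<close>

definition extends_to_perfect :: "'a graph \<Rightarrow> 'a set set \<Rightarrow> bool" where
  "extends_to_perfect G M \<longleftrightarrow> (\<exists>P. perfect_matching G P \<and> M \<subseteq> P)"

text \<open>An automorphism permutes the finitely many edges, so a perfect matching through the image of
  \<open>M\<close> can be pulled back.\<close>
lemma extends_to_perfect_automorphism:
  assumes G: "finite_simple_graph G"
    and f: "inj_on f (verts G)" "f ` verts G \<subseteq> verts G" "\<And>e. e \<in> edges G \<Longrightarrow> f ` e \<in> edges G"
    and M: "M \<subseteq> edges G" and ext: "extends_to_perfect G ((`) f ` M)"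
  shows "extends_to_perfect G M"
proof -
  obtain P where P: "P \<subseteq> edges G" "pairwise disjnt P" "\<Union>P = verts G" "(`) f ` M \<subseteq> P"
    using ext by (auto simp: extends_to_perfect_def perfect_matching_def matching_def)
  have sub: "e \<subseteq> verts G" if "e \<in> edges G" for e
    using G that by (auto simp: finite_simple_graph_def)
  have fin: "finite (edges G)"
    using G by (auto simp: finite_simple_graph_def intro: finite_subset[of _ "Pow (verts G)"])
  have "inj_on ((`) f) (edges G)"
    using inj_on_image_Pow[OF f(1)] by (rule inj_on_subset) (use sub in auto)
  then have surj: "(`) f ` edges G = edges G"
    using fin f(3) by (intro endo_inj_surj) auto
  have "perfect_matching G {e \<in> edges G. f ` e \<in> P}"
    unfolding perfect_matching_def matching_def
  proof (intro conjI)
    show "pairwise disjnt {e \<in> edges G. f ` e \<in> P}"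
    proof (rule pairwiseI)
      fix e e' assume e: "e \<in> {e \<in> edges G. f ` e \<in> P}" "e' \<in> {e \<in> edges G. f ` e \<in> P}" "e \<noteq> e'"
      then have "f ` e \<noteq> f ` e'"
        using \<open>inj_on ((`) f) (edges G)\<close> by (auto dest: inj_onD)
      then have "disjnt (f ` e) (f ` e')" using P(2) e by (auto simp: pairwise_def)
      then show "disjnt e e'" by (auto simp: disjnt_def)
    qed
    show "\<Union>{e \<in> edges G. f ` e \<in> P} = verts G"
    proof
      show "verts G \<subseteq> \<Union>{e \<in> edges G. f ` e \<in> P}"
      proof
        fix v assume v: "v \<in> verts G"
        then have "f v \<in> \<Union>P" using f(2) P(3) by auto
        then obtain e' where "e' \<in> P" "f v \<in> e'" by auto
        then obtain e where e: "e \<in> edges G" "e' = f ` e" using surj P(1) by blast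
        then have "v \<in> e" using \<open>f v \<in> e'\<close> f(1) v sub[OF e(1)] by (auto dest: inj_onD)
        then show "v \<in> \<Union>{e \<in> edges G. f ` e \<in> P}" using e \<open>e' \<in> P\<close> by auto
      qed
    qed (use sub in auto)
  qed auto
  then show ?thesis
    using P(4) M unfolding extends_to_perfect_def
    by (intro exI[of _ "{e \<in> edges G. f ` e \<in> P}"]) auto
qed

lemma k_matching_image:
  assumes "inj_on f (verts G)" "\<And>e. e \<in> edges G \<Longrightarrow> e \<subseteq> verts G \<and> f ` e \<in> edges G"
    and "k_matching n G M"
  shows "k_matching n G ((`) f ` M)"
proof -
  have M: "M \<subseteq> edges G" "pairwise disjnt M" "finite M" "card M = n"
    using assms(3) by (auto simp: k_matching_def matching_def)
  have "inj_on ((`) f) M"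
    using inj_on_image_Pow[OF assms(1)] by (rule inj_on_subset) (use assms(2) M in auto)
  moreover have "pairwise disjnt ((`) f ` M)"
  proof (rule pairwiseI)
    fix a b assume ab: "a \<in> (`) f ` M" "b \<in> (`) f ` M" "a \<noteq> b"
    then obtain c d where cd: "a = f ` c" "b = f ` d" "c \<in> M" "d \<in> M" "c \<noteq> d" by auto
    then have "c \<inter> d = {}" "c \<subseteq> verts G" "d \<subseteq> verts G"
      using M assms(2)[of c] assms(2)[of d] by (auto simp: pairwise_def disjnt_def)
    then show "disjnt a b" using assms(1) cd unfolding disjnt_def inj_on_def by blast
  qed
  ultimately show ?thesis
    using M assms(2) by (auto simp: k_matching_def matching_def card_image)
qed

text \<open>A perfect matching is an involution sending each vertex to a neighbour. In this form it can be
  modified by a case distinction on vertices, without a new disjointness argument.\<close>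
lemma extends_to_perfectD:
  assumes G: "finite_simple_graph G" and "extends_to_perfect G M"
  obtains g where "\<And>v. v \<in> verts G \<Longrightarrow> g v \<in> verts G \<and> g (g v) = v \<and> {v, g v} \<in> edges G"
    and "\<And>a b. {a, b} \<in> M \<Longrightarrow> g a = b"
proof -
  obtain P where P: "P \<subseteq> edges G" "pairwise disjnt P" "\<Union>P = verts G" "M \<subseteq> P"
    using assms(2) by (auto simp: extends_to_perfect_def perfect_matching_def matching_def)
  have P2: "e \<subseteq> verts G" "card e = 2" if "e \<in> P" for e
    using G that P(1) by (auto simp: finite_simple_graph_def)
  have "\<exists>w. {v, w} \<in> P" if v: "v \<in> verts G" for v
  proof -
    obtain e where e: "e \<in> P" "v \<in> e" using P(3) v by auto
    then obtain a b where "e = {a, b}" using P2(2)[of e] by (auto simp: card_2_iff)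
    then have "e = {v, a} \<or> e = {v, b}" using e(2) by blast
    then show ?thesis using e(1) by blast
  qed
  then obtain g where g: "\<And>v. v \<in> verts G \<Longrightarrow> {v, g v} \<in> P" by metis
  have uniq: "w = u" if "{v, w} \<in> P" "{v, u} \<in> P" for v w u
  proof -
    have "{v, w} = {v, u}" using pairwiseD[OF P(2) that] by (auto simp: disjnt_def)
    then show ?thesis by (auto simp: doubleton_eq_iff)
  qed
  show ?thesis
  proof
    fix v assume v: "v \<in> verts G"
    then have "g v \<in> verts G" using g P2(1) by blast
    moreover from this have "g (g v) = v"
      using uniq[of "g v" "g (g v)" v] g[of v] g[of "g v"] v by (simp add: insert_commute[of v])
    ultimately show "g v \<in> verts G \<and> g (g v) = v \<and> {v, g v} \<in> edges G" using g v P(1) by auto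
  next
    fix a b assume ab: "{a, b} \<in> M"
    then have "a \<in> verts G" using P by auto
    then show "g a = b" using uniq g ab P(4) by blast
  qed
qed

lemma extends_to_perfectI:
  assumes "\<And>v. v \<in> verts G \<Longrightarrow> g v \<in> verts G \<and> g (g v) = v \<and> {v, g v} \<in> edges G"
    and "\<And>e. e \<in> M \<Longrightarrow> \<exists>a b. a \<in> verts G \<and> e = {a, b} \<and> g a = b"
  shows "extends_to_perfect G M"
proof -
  let ?P = "(\<lambda>v. {v, g v}) ` verts G"
  have inv: "g (g v) = v" "g v \<in> verts G" "{v, g v} \<in> edges G" if "v \<in> verts G" for v
    using assms(1) that by blast+
  have "pairwise disjnt ?P"
  proof (rule pairwiseI)
    fix e e' assume ee': "e \<in> ?P" "e' \<in> ?P" "e \<noteq> e'"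
    have "d = {x, g x}" if d: "d \<in> ?P" "x \<in> d" for d x
    proof -
      obtain v where v: "v \<in> verts G" "d = {v, g v}" using d(1) by blast
      then consider "x = v" | "x = g v" using d(2) by blast
      then show ?thesis by cases (use v inv(1)[OF v(1)] in \<open>simp_all add: insert_commute\<close>)
    qed
    then show "disjnt e e'" using ee' unfolding disjnt_iff by metis
  qed
  moreover have "\<Union>?P = verts G" using inv(2) by auto
  moreover have "?P \<subseteq> edges G" using inv(3) by (rule image_subsetI)
  ultimately have "perfect_matching G ?P"
    by (simp add: perfect_matching_def matching_def)
  moreover have "M \<subseteq> ?P" using assms(2) by blast
  ultimately show ?thesis unfolding extends_to_perfect_def by (intro exI conjI)
qed

section \<open>Pentagonal prisms with a twist\<close>

text \<open>The vertex \<open>5 * i + b\<close> is the point \<open>b\<close> of the pentagon over the point \<open>i\<close> of the base cycle; such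
  a pentagon is called slice \<open>i\<close>. The function \<open>up\<close> runs around a pentagon and \<open>turn\<close> runs along the
  base. Leaving the last slice, \<open>turn\<close> applies the reflection \<open>b \<mapsto> - b\<close> of the pentagon.\<close>
definition up :: "nat \<Rightarrow> nat" where
  "up v = 5 * (v div 5) + (v mod 5 + 1) mod 5"

definition turn :: "nat \<Rightarrow> nat \<Rightarrow> nat" where
  "turn k v = (if v + 5 < 5 * k then v + 5 else (5 - v mod 5) mod 5)"

text \<open>With the identity in place of the reflection, this would be the product of a pentagon and a cycle,
  which lies on the torus. The reflection turns the torus into the Klein bottle.\<close>
definition twisted_prism :: "nat \<Rightarrow> nat graph" where
  "twisted_prism k =
     ({..<5 * k}, (\<lambda>v. {v, up v}) ` {..<5 * k} \<union> (\<lambda>v. {v, turn k v}) ` {..<5 * k})"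

lemma verts_twisted_prism [simp]: "verts (twisted_prism k) = {..<5 * k}"
  by (simp add: twisted_prism_def)

lemma twisted_prism_edgeE:
  assumes "e \<in> edges (twisted_prism k)"
  obtains v where "v < 5 * k" "e = {v, up v}" | v where "v < 5 * k" "e = {v, turn k v}"
  using assms by (auto simp: twisted_prism_def)

lemma up_edge: "v < 5 * k \<Longrightarrow> {v, up v} \<in> edges (twisted_prism k)"
  by (auto simp: twisted_prism_def)

lemma turn_edge: "v < 5 * k \<Longrightarrow> {v, turn k v} \<in> edges (twisted_prism k)"
  by (auto simp: twisted_prism_def)

lemma up_div [simp]: "up v div 5 = v div 5"
  by (simp add: up_def)

lemma up_less: "v < 5 * k \<Longrightarrow> up v < 5 * k"
  by (metis up_div div_less_iff_less_mult mult.commute zero_less_numeral)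

lemma up_mod: "up v mod 5 = (v + 1) mod 5"
  by (simp add: up_def mod_simps)

lemma up_neq: "up v \<noteq> v"
proof -
  have "(v + 1) mod 5 \<noteq> v mod 5" by presburger
  then show ?thesis using up_mod[of v] by metis
qed

lemma before_last_slice: "v + 5 < 5 * k \<longleftrightarrow> v div 5 + 1 < k" for v k :: nat
  using div_less_iff_less_mult[of 5 "v + 5" k] by (simp add: mult.commute)

lemma turn_less: "0 < k \<Longrightarrow> turn k v < 5 * k"
  unfolding turn_def by (auto intro: less_le_trans[of _ 5])

lemma turn_neq: "2 \<le> k \<Longrightarrow> v < 5 * k \<Longrightarrow> turn k v \<noteq> v"
proof -
  assume "2 \<le> k" "v < 5 * k"
  moreover have "(5 - v mod 5) mod 5 < 5" by (rule mod_less_divisor) simp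
  ultimately show ?thesis unfolding turn_def by (auto split: if_split)
qed

lemma turn_div: "v < 5 * k \<Longrightarrow> turn k v div 5 = (v div 5 + 1) mod k"
proof -
  assume v: "v < 5 * k"
  show ?thesis
  proof (cases "v + 5 < 5 * k")
    case True
    then have "v div 5 + 1 < k" by (simp add: before_last_slice)
    then show ?thesis using True by (simp add: turn_def)
  next
    case False
    then have "v div 5 + 1 = k"
      using v before_last_slice[of v k] less_mult_imp_div_less[of v k 5] by linarith
    then show ?thesis using False by (simp add: turn_def)
  qed
qed

lemma inj_on_turn: "inj_on (turn k) {..<5 * k}"
proof (rule inj_onI)
  fix v w assume "v \<in> {..<5 * k}" "w \<in> {..<5 * k}" and eq: "turn k v = turn k w"
  then have vw: "v < 5 * k" "w < 5 * k" by auto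
  have less: "(5 - u mod 5) mod 5 < (5 :: nat)" for u by simp
  have mod: "v mod 5 = w mod 5" if "(5 - v mod 5) mod 5 = (5 - w mod 5) mod (5 :: nat)"
  proof -
    have "(5 - (5 - u mod 5) mod 5) mod 5 = u mod 5" for u :: nat
      using mod_less_divisor[of 5 u] by (cases "u mod 5 = 0") auto
    then show ?thesis using that by metis
  qed
  consider "v + 5 < 5 * k" "w + 5 < 5 * k" | "v + 5 < 5 * k" "\<not> w + 5 < 5 * k"
    | "\<not> v + 5 < 5 * k" "w + 5 < 5 * k" | "\<not> v + 5 < 5 * k" "\<not> w + 5 < 5 * k"
    by blast
  then show "v = w"
  proof cases
    case 1
    then show ?thesis using eq by (simp add: turn_def)
  next
    case 2
    then show ?thesis using eq less[of w] by (simp add: turn_def)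
  next
    case 3
    then show ?thesis using eq less[of v] by (simp add: turn_def)
  next
    case 4
    then have "v mod 5 = w mod 5" using eq mod by (simp add: turn_def)
    moreover have "v div 5 = w div 5"
      using 4 vw before_last_slice[of v k] before_last_slice[of w k]
        less_mult_imp_div_less[of v k 5] less_mult_imp_div_less[of w k 5] by linarith
    ultimately show ?thesis by (metis div_mult_mod_eq)
  qed
qed

lemma finite_simple_graph_twisted_prism:
  assumes "2 \<le> k"
  shows "finite_simple_graph (twisted_prism k)"
proof -
  have "card {v, up v} = 2" "v < 5 * k \<Longrightarrow> card {v, turn k v} = 2" for v
    using up_neq[of v] turn_neq[OF assms, of v] by auto
  moreover have "turn k v < 5 * k" for v using assms turn_less by simp
  ultimately show ?thesis
    using up_less by (simp add: finite_simple_graph_def twisted_prism_def ball_Un)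
qed

text \<open>Either alternative can occur: the reflection reverses the direction of \<open>up\<close>.\<close>
lemma turn_up:
  assumes "v < 5 * k"
  shows "turn k (up v) = up (turn k v) \<or> turn k v = up (turn k (up v))"
proof (cases "v + 5 < 5 * k")
  case True
  then have "up v + 5 < 5 * k" by (simp add: before_last_slice del: add_less_cancel_left)
  moreover have "up (v + 5) = up v + 5" by (simp add: up_def)
  ultimately show ?thesis using True by (simp add: turn_def)
next
  case False
  then have up_last: "\<not> up v + 5 < 5 * k" by (simp add: before_last_slice)
  have up_mod: "up v mod 5 = (v mod 5 + 1) mod 5"
    by (simp add: up_def)
  have up_small: "up w = (w + 1) mod 5" if "w < 5" for w
    using that by (simp add: up_def)
  consider "v mod 5 = 0" | "v mod 5 = 1" | "v mod 5 = 2" | "v mod 5 = 3" | "v mod 5 = 4"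
    using mod_less_divisor[of 5 v] by linarith
  then show ?thesis
    by cases (use False up_last up_mod up_small in \<open>simp_all add: turn_def\<close>)
qed

text \<open>By this, \<open>turn k\<close> is an automorphism: a rotation by one slice, of order \<open>2 * k\<close>.\<close>
lemma turn_image_edge:
  assumes "0 < k" "e \<in> edges (twisted_prism k)"
  shows "turn k ` e \<in> edges (twisted_prism k)"
proof -
  consider v where "v < 5 * k" "e = {v, up v}" | v where "v < 5 * k" "e = {v, turn k v}"
    using assms by (auto simp: twisted_prism_def)
  then show ?thesis
  proof cases
    case 1
    then have "turn k ` e = {turn k v, up (turn k v)} \<or>
        turn k ` e = {turn k (up v), up (turn k (up v))}"
      using turn_up[of v k] by auto
    then show ?thesis using turn_less[OF assms(1)] by (auto simp: twisted_prism_def)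
  next
    case 2
    then show ?thesis using turn_less[OF assms(1)] by (auto simp: twisted_prism_def)
  qed
qed

lemma funpow_turn:
  assumes "2 \<le> k"
  shows "inj_on (turn k ^^ j) {..<5 * k}" "(turn k ^^ j) ` {..<5 * k} \<subseteq> {..<5 * k}"
    and "e \<in> edges (twisted_prism k) \<Longrightarrow> (turn k ^^ j) ` e \<in> edges (twisted_prism k)"
    and "v < 5 * k \<Longrightarrow> (turn k ^^ j) v div 5 = (v div 5 + j) mod k"
proof -
  have less: "turn k v < 5 * k" for v using assms turn_less by simp
  have "inj_on (turn k ^^ j) {..<5 * k} \<and> (turn k ^^ j) ` {..<5 * k} \<subseteq> {..<5 * k}"
  proof (induction j)
    case (Suc j)
    then have "inj_on (turn k \<circ> (turn k ^^ j)) {..<5 * k}"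
      using inj_on_turn by (blast intro: comp_inj_on inj_on_subset)
    then show ?case using less by (auto simp: comp_def)
  qed simp
  then show "inj_on (turn k ^^ j) {..<5 * k}" "(turn k ^^ j) ` {..<5 * k} \<subseteq> {..<5 * k}"
    by auto
  show "(turn k ^^ j) ` e \<in> edges (twisted_prism k)" if "e \<in> edges (twisted_prism k)"
  proof (induction j)
    case (Suc j)
    have "(turn k ^^ Suc j) ` e = turn k ` (turn k ^^ j) ` e" by (auto simp: image_comp)
    then show ?case using turn_image_edge[OF _ Suc] assms by simp
  qed (use that in simp)
  show "(turn k ^^ j) v div 5 = (v div 5 + j) mod k" if v: "v < 5 * k"
  proof (induction j)
    case 0
    show ?case using less_mult_imp_div_less[of v k 5] v by (simp add: mult.commute)
  next
    case (Suc j)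
    have "(turn k ^^ j) v < 5 * k" using v less by (cases j) auto
    then have "turn k ((turn k ^^ j) v) div 5 = ((v div 5 + j) mod k + 1) mod k"
      using Suc turn_div by simp
    then show ?case by (simp add: mod_simps)
  qed
qed

lemma extends_rotate:
  assumes "2 \<le> k" "k_matching n (twisted_prism k) M"
    and "extends_to_perfect (twisted_prism k) ((`) (turn k ^^ j) ` M)"
  shows "extends_to_perfect (twisted_prism k) M"
proof (rule extends_to_perfect_automorphism[OF finite_simple_graph_twisted_prism])
  show "M \<subseteq> edges (twisted_prism k)"
    using assms(2) by (simp add: k_matching_def matching_def)
qed (use assms funpow_turn[OF assms(1), where j = j] in \<open>simp_all only: verts_twisted_prism\<close>)

lemma k_matching_rotate:
  assumes "2 \<le> k" "k_matching n (twisted_prism k) M"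
  shows "k_matching n (twisted_prism k) ((`) (turn k ^^ j) ` M)"
proof -
  have "e \<subseteq> {..<5 * k}" if "e \<in> edges (twisted_prism k)" for e
    using finite_simple_graph_twisted_prism[OF assms(1)] that by (auto simp: finite_simple_graph_def)
  then show ?thesis
    using assms funpow_turn[OF assms(1), where j = j] by (intro k_matching_image) auto
qed

lemma not_bipartite_twisted_prism:
  assumes "0 < k"
  shows "\<not> bipartite (twisted_prism k)"
proof
  assume "bipartite (twisted_prism k)"
  then obtain A B where AB: "A \<inter> B = {}"
    "\<forall>e\<in>edges (twisted_prism k). \<exists>a\<in>A. \<exists>b\<in>B. e = {a, b}"
    by (auto simp only: bipartite_def)
  have flip: "(v \<in> A \<and> w \<in> B) \<or> (v \<in> B \<and> w \<in> A)" if vw: "v < 5" "w = up v" for v w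
  proof -
    have "{v, w} \<in> edges (twisted_prism k)" using up_edge[of v k] vw assms by simp
    then obtain a b where "a \<in> A" "b \<in> B" "{v, w} = {a, b}" using AB(2) by blast
    then show ?thesis by (auto simp: doubleton_eq_iff)
  qed
  have "up 0 = 1" "up 1 = 2" "up 2 = 3" "up 3 = 4" "up 4 = 0" by (simp_all add: up_def)
  then show False
    using AB(1) flip[of 0 1] flip[of 1 2] flip[of 2 3] flip[of 3 4] flip[of 4 0] by auto
qed

text \<open>Match slice \<open>2 * i\<close> with slice \<open>2 * i + 1\<close> along the base.\<close>
lemma perfect_matching_twisted_prism:
  assumes "even k"
  shows "\<exists>P. perfect_matching (twisted_prism k) P"
proof -
  define g where "g v = (if even (v div 5) then v + 5 else v - 5)" for v :: nat
  have "g v < 5 * k \<and> g (g v) = v \<and> {v, g v} \<in> edges (twisted_prism k)" if v: "v < 5 * k" for v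
  proof (cases "even (v div 5)")
    case True
    have "v div 5 < k" using v less_mult_imp_div_less[of v k 5] by (simp add: mult.commute)
    then have "v div 5 + 1 < k" using True assms by (cases "v div 5 + 1 = k") auto
    then have "v + 5 < 5 * k" by (simp only: before_last_slice)
    then show ?thesis
      using True turn_edge[OF v] by (simp add: g_def turn_def)
  next
    case False
    then have "5 \<le> v" by (cases "v < 5") auto
    then obtain u where u: "v = u + 5" using le_Suc_ex by (metis add.commute)
    then have "even (u div 5)" using False by simp
    then show ?thesis
      using False u v turn_edge[of u k] by (simp add: g_def turn_def insert_commute)
  qed
  then have "extends_to_perfect (twisted_prism k) {}"
    by (intro extends_to_perfectI[of _ g]) auto
  then show ?thesis by (simp add: extends_to_perfect_def)
qed

section \<open>Inserting and deleting two slices\<close>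

text \<open>For at least three slices, the last and the first one are joined only by the edges of \<open>turn\<close>.\<close>
lemma wrap_edge:
  assumes "3 \<le> k" "{v, w} \<in> edges (twisted_prism k)" "5 * k \<le> v + 5" "w < 5"
  shows "w = turn k v"
  using assms(2)
proof (cases rule: twisted_prism_edgeE)
  case (1 x)
  then have "v div 5 = w div 5" by (auto simp: doubleton_eq_iff)
  then have "v div 5 = 0" using assms(4) by simp
  then have "v < 5" by simp
  then show ?thesis using assms(1,3) by linarith
next
  case (2 x)
  moreover have "turn k w = w + 5" using assms by (simp add: turn_def)
  ultimately show ?thesis using assms by (auto simp: doubleton_eq_iff)
qed

lemma edge_insert_slices:
  assumes "{v, w} \<in> edges (twisted_prism k)"
    and "\<not> (5 * k \<le> v + 5 \<and> w < 5)" "\<not> (5 * k \<le> w + 5 \<and> v < 5)"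
  shows "{v, w} \<in> edges (twisted_prism (k + 2))"
  using assms(1)
proof (cases rule: twisted_prism_edgeE)
  case (1 x)
  then show ?thesis using up_edge[of x "k + 2"] by simp
next
  case (2 x)
  have "turn k x < 5" if "\<not> x + 5 < 5 * k" using that by (simp add: turn_def)
  then have "x + 5 < 5 * k" using 2 assms(2,3) by (fastforce simp: doubleton_eq_iff)
  then have "turn k x = turn (k + 2) x" by (simp add: turn_def)
  then show ?thesis using turn_edge[of x "k + 2"] 2 by simp
qed

lemma edge_delete_slices:
  assumes "3 \<le> k" "e \<in> edges (twisted_prism (k + 2))" "e \<subseteq> {..<5 * k}"
  shows "e \<in> edges (twisted_prism k)"
    and "e = {v, w} \<Longrightarrow> \<not> (5 * k \<le> v + 5 \<and> w < 5)"
proof -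
  have "e \<in> edges (twisted_prism k) \<and> \<not> (\<exists>v w. e = {v, w} \<and> 5 * k \<le> v + 5 \<and> w < 5)"
    using assms(2)
  proof (cases rule: twisted_prism_edgeE)
    case (1 x)
    have "\<not> (5 * k \<le> v + 5 \<and> w < 5)" if "e = {v, w}" for v w
    proof
      assume vw: "5 * k \<le> v + 5 \<and> w < 5"
      have "v div 5 = w div 5" using 1 that by (auto simp: doubleton_eq_iff)
      then have "v div 5 = 0" using vw by simp
      then have "v < 5" by simp
      then show False using vw assms(1) by linarith
    qed
    then show ?thesis using 1 assms(3) up_edge by auto
  next
    case (2 x)
    then have x: "x < 5 * k" "turn (k + 2) x = x + 5" using assms(3) by (auto simp: turn_def)
    then have "x + 5 < 5 * k" using 2 assms(3) by auto
    then have "turn k x = x + 5" by (simp add: turn_def)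
    moreover have "\<not> (5 * k \<le> v + 5 \<and> w < 5)" if "e = {v, w}" for v w
      using that 2 x assms(1) by (auto simp: doubleton_eq_iff)
    ultimately show ?thesis using 2 x turn_edge[of x k] by auto
  qed
  then show "e \<in> edges (twisted_prism k)" "e = {v, w} \<Longrightarrow> \<not> (5 * k \<le> v + 5 \<and> w < 5)"
    by auto
qed

text \<open>Two new slices are put between the last and the first one. A column in which the old perfect
  matching crosses this gap is matched across both ends of the new part; in every other column the two
  new vertices are matched with each other. So no parity condition arises, and only the edges in the gap are
  lost, which \<open>M\<close> avoids because it has no vertex in the new slices.\<close>
lemma extends_insert_slices:
  assumes k: "3 \<le> k" and M: "M \<subseteq> edges (twisted_prism (k + 2))" "\<Union>M \<subseteq> {..<5 * k}"
    and ext: "extends_to_perfect (twisted_prism k) M"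
  shows "extends_to_perfect (twisted_prism (k + 2)) M"
proof -
  let ?G = "twisted_prism (k + 2)"
  have fsg: "finite_simple_graph (twisted_prism k)"
    using k by (intro finite_simple_graph_twisted_prism) simp
  obtain g where g: "\<And>v. v < 5 * k \<Longrightarrow> g v < 5 * k \<and> g (g v) = v \<and> {v, g v} \<in> edges (twisted_prism k)"
    and gM: "\<And>a b. {a, b} \<in> M \<Longrightarrow> g a = b"
    using extends_to_perfectD[OF fsg ext] by (auto simp: lessThan_iff)
  \<comment> \<open>The last slice of the old prism consists of the \<open>v\<close> with \<open>5 * k \<le> v + 5\<close>,
    the first one of the \<open>v < 5\<close>.\<close>
  define h where "h v =
    (if v < 5 * k then
       if 5 * k \<le> v + 5 \<and> g v < 5 then v + 5
       else if v < 5 \<and> 5 * k \<le> g v + 5 then g v + 10 else g v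
     else if v < 5 * k + 5 then if g (v - 5) < 5 then v - 5 else v + 5
     else if g (v - 10) < 5 then g (v - 10) else v - 5)" for v
  have turn1: "turn (k + 2) v = v + 5" if "v < 5 * k + 5" for v
    using that by (simp add: turn_def)
  have turn2: "turn (k + 2) (v + 10) = turn k v" if "5 * k \<le> v + 5" for v
  proof -
    have "(v + 10) mod 5 = v mod 5" by presburger
    then show ?thesis using that by (simp add: turn_def)
  qed
  have "h v < 5 * (k + 2) \<and> h (h v) = v \<and> {v, h v} \<in> edges ?G" if v: "v < 5 * (k + 2)" for v
  proof -
    consider (last) "v < 5 * k" "5 * k \<le> v + 5" "g v < 5"
      | (first) "v < 5 * k" "v < 5" "5 * k \<le> g v + 5"
      | (old) "v < 5 * k" "\<not> (5 * k \<le> v + 5 \<and> g v < 5)" "\<not> (5 * k \<le> g v + 5 \<and> v < 5)"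
      | (new1) u where "v = u + 5" "5 * k \<le> u + 5" "u < 5 * k"
      | (new2) u where "v = u + 10" "5 * k \<le> u + 5" "u < 5 * k"
    proof -
      consider "v < 5 * k" | "5 * k \<le> v" "v < 5 * k + 5" | "5 * k + 5 \<le> v" by linarith
      then show thesis
      proof cases
        case 1
        then show thesis using last first old by blast
      next
        case 2
        then show thesis using k by (intro new1[of "v - 5"]) auto
      next
        case 3
        then show thesis using k v by (intro new2[of "v - 10"]) auto
      qed
    qed
    then show ?thesis
    proof cases
      case last
      then have "h v = v + 5" "h (v + 5) = v" using k by (simp_all add: h_def)
      then show ?thesis using last turn1[of v] turn_edge[of v "k + 2"] by simp
    next
      case first
      then have "h v = g v + 10" "h (g v + 10) = v" using g[of v] k by (simp_all add: h_def)
      moreover have "v = turn k (g v)"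
        using wrap_edge[OF k, of "g v" v] first g[of v] by (simp add: insert_commute)
      ultimately show ?thesis
        using first g[of v] turn2[of "g v"] turn_edge[of "g v + 10" "k + 2"]
        by (simp add: insert_commute)
    next
      case old
      then have "h v = g v" using k by (auto simp: h_def)
      moreover have "h (g v) = v" using old k g[of v] by (auto simp: h_def)
      ultimately show ?thesis using old g[of v] edge_insert_slices[of v "g v" k] by simp
    next
      case new1
      show ?thesis
      proof (cases "g u < 5")
        case True
        then have "h v = u" "h u = v" using new1 k by (auto simp: h_def)
        then show ?thesis
          using new1 turn1[of u] turn_edge[of u "k + 2"] by (simp add: insert_commute)
      next
        case False
        then have "h v = u + 10" "h (u + 10) = v" using new1 k by (auto simp: h_def)
        moreover have "turn (k + 2) (u + 5) = u + 10" using new1 by (simp add: turn_def)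
        ultimately show ?thesis using new1 turn_edge[of "u + 5" "k + 2"] by simp
      qed
    next
      case new2
      show ?thesis
      proof (cases "g u < 5")
        case True
        then have "h v = g u" using new2 by (auto simp: h_def)
        moreover have "h (g u) = v" using new2 True k g[of u] by (auto simp: h_def)
        moreover have "g u = turn k u"
          using wrap_edge[OF k, of u "g u"] new2 True g[of u] by simp
        ultimately show ?thesis
          using new2 turn2[of u] turn_edge[of "u + 10" "k + 2"] g[of u] by simp
      next
        case False
        then have "h v = u + 5" "h (u + 5) = v" using new2 k by (auto simp: h_def)
        moreover have "turn (k + 2) (u + 5) = u + 10" using new2 by (simp add: turn_def)
        ultimately show ?thesis
          using new2 turn_edge[of "u + 5" "k + 2"] by (simp add: insert_commute)
      qed
    qed
  qed
  moreover have "\<exists>a b. a \<in> verts ?G \<and> e = {a, b} \<and> h a = b" if "e \<in> M" for e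
  proof -
    have e: "e \<in> edges ?G" "e \<subseteq> {..<5 * k}" using M that by auto
    obtain a b where ab: "e = {a, b}"
      using e(1) by (auto elim: twisted_prism_edgeE)
    then have "g a = b" using gM that by simp
    moreover have "\<not> (5 * k \<le> a + 5 \<and> b < 5)" "\<not> (5 * k \<le> b + 5 \<and> a < 5)"
      using edge_delete_slices(2)[OF k e, of a b] edge_delete_slices(2)[OF k e, of b a] ab
      by (simp_all add: insert_commute)
    ultimately have "h a = b" using e(2) ab by (auto simp: h_def)
    then show ?thesis using ab e(2) by (intro exI[of _ a] exI[of _ b]) auto
  qed
  ultimately show ?thesis by (intro extends_to_perfectI[of _ h]) auto
qed

lemma edge_slices:
  assumes "0 < k" "e \<in> edges (twisted_prism k)"
  obtains a where "a < k" "\<And>v. v \<in> e \<Longrightarrow> v div 5 = a \<or> v div 5 = (a + 1) mod k"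
  using assms(2)
proof (cases rule: twisted_prism_edgeE)
  case (1 x)
  then show thesis
    using less_mult_imp_div_less[of x k 5] by (intro that[of "x div 5"]) (auto simp: mult.commute)
next
  case (2 x)
  then show thesis
    using less_mult_imp_div_less[of x k 5] turn_div[of x k]
    by (intro that[of "x div 5"]) (auto simp: mult.commute)
qed

text \<open>An edge lies in one slice or in two consecutive ones, so it meets at most three of the \<open>k\<close> pairs of
  consecutive slices. Three edges meet at most nine.\<close>
lemma two_free_slices:
  assumes k: "10 \<le> k" and M: "k_matching 3 (twisted_prism k) M"
  obtains s where "s < k" "\<And>v. v \<in> \<Union>M \<Longrightarrow> v div 5 \<noteq> s \<and> v div 5 \<noteq> (s + 1) mod k"
proof -
  \<comment> \<open>The positions of pairs of consecutive slices that \<open>e\<close> meets.\<close>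
  define B where "B e = {s. s < k \<and> (\<exists>v\<in>e. v div 5 = s \<or> v div 5 = (s + 1) mod k)}" for e :: "nat set"
  have fin: "finite (B e)" for e by (simp add: B_def)
  have B3: "card (B e) \<le> 3" if e: "e \<in> M" for e
  proof -
    obtain a where a: "a < k" "\<And>v. v \<in> e \<Longrightarrow> v div 5 = a \<or> v div 5 = (a + 1) mod k"
      using edge_slices[of k e] k M e by (auto simp: k_matching_def matching_def)
    have near: "s = a \<or> s = (a + 1) mod k \<or> s = (a + k - 1) mod k"
      if "s < k" "(s + 1) mod k = a \<or> (s + 1) mod k = (a + 1) mod k \<or> s = a \<or> s = (a + 1) mod k" for s
    proof -
      have suc: "(i + 1) mod k = (if i + 1 = k then 0 else i + 1)" if "i < k" for i
        using that by auto
      have pred: "(a + k - 1) mod k = (if a = 0 then k - 1 else a - 1)"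
      proof (cases "a = 0")
        case False
        then have "a + k - 1 = (a - 1) + k" by simp
        then show ?thesis using a(1) False by (simp only: mod_add_self2) simp
      qed (use k in simp)
      then show ?thesis
        using that a(1) unfolding pred suc[OF that(1)] suc[OF a(1)]
        by (auto split: if_splits)
    qed
    have "B e \<subseteq> {a, (a + 1) mod k, (a + k - 1) mod k}"
    proof
      fix s assume "s \<in> B e"
      then obtain v where "s < k" "v \<in> e" "v div 5 = s \<or> v div 5 = (s + 1) mod k"
        by (auto simp: B_def)
      then show "s \<in> {a, (a + 1) mod k, (a + k - 1) mod k}"
        using near[of s] a(2)[of v] by auto
    qed
    then have "card (B e) \<le> card {a, (a + 1) mod k, (a + k - 1) mod k}"
      by (intro card_mono) auto
    also have "\<dots> \<le> 3" by (simp add: card_insert_if)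
    finally show ?thesis .
  qed
  have "card (\<Union>e\<in>M. B e) \<le> (\<Sum>e\<in>M. card (B e))"
    using M fin by (intro card_UN_le) (auto simp: k_matching_def)
  also have "\<dots> \<le> card M * 3" using sum_bounded_above[of M "\<lambda>e. card (B e)" 3] B3 by simp
  also have "\<dots> < card {..<k}" using M k by (simp add: k_matching_def)
  finally have "\<not> {..<k} \<subseteq> (\<Union>e\<in>M. B e)"
    using M fin card_mono[of "\<Union>e\<in>M. B e" "{..<k}"] by (auto simp: k_matching_def)
  then obtain s where "s < k" "\<And>e. e \<in> M \<Longrightarrow> s \<notin> B e" by auto
  then show thesis using that[of s] by (auto simp: B_def)
qed

text \<open>Two consecutive untouched slices are rotated to the end, where they are deleted.\<close>
lemma extends_step:
  assumes k: "8 \<le> k"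
    and IH: "\<And>M. k_matching 3 (twisted_prism k) M \<Longrightarrow> extends_to_perfect (twisted_prism k) M"
    and M: "k_matching 3 (twisted_prism (k + 2)) M"
  shows "extends_to_perfect (twisted_prism (k + 2)) M"
proof -
  obtain s where s: "s < k + 2" "\<And>v. v \<in> \<Union>M \<Longrightarrow> v div 5 \<noteq> s \<and> v div 5 \<noteq> (s + 1) mod (k + 2)"
    using two_free_slices[OF _ M] k by auto
  \<comment> \<open>Rotation by \<open>k - s\<close> slices; the summand \<open>k + 2\<close>, a full turn, keeps the number nonnegative.\<close>
  define j where "j = 2 * k + 2 - s"
  define N where "N = (`) (turn (k + 2) ^^ j) ` M"
  have N: "k_matching 3 (twisted_prism (k + 2)) N"
    unfolding N_def using k M by (intro k_matching_rotate) auto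
  have shift: "(i + j) mod (k + 2) < k" if i: "i < k + 2" "i \<noteq> s" "i \<noteq> (s + 1) mod (k + 2)" for i
  proof (cases "i < s")
    case True
    have "\<not> (s = k + 1 \<and> i = 0)" using i by auto
    then have "s - i \<le> k" using s(1) by linarith
    then have "i + j = (k + 2) + (k - (s - i))" using True s(1) unfolding j_def by linarith
    then have "(i + j) mod (k + 2) = k - (s - i)" by (simp only: mod_add_self1) simp
    then show ?thesis using True k by simp
  next
    case False
    then have "s + 2 \<le> i" using i by (cases "i = s + 1") auto
    then obtain d where d: "i = s + 2 + d" using le_Suc_ex by blast
    then have "i + j = 2 * (k + 2) + d" using s(1) unfolding j_def by simp
    then have "(i + j) mod (k + 2) = d mod (k + 2)" by (simp only: mod_mult_self3)
    moreover have "d < k" using i(1) d by simp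
    ultimately show ?thesis by simp
  qed
  have free: "\<Union>N \<subseteq> {..<5 * k}"
  proof
    fix w assume "w \<in> \<Union>N"
    then obtain v where v: "v \<in> \<Union>M" "w = (turn (k + 2) ^^ j) v" by (auto simp: N_def)
    have fsg: "finite_simple_graph (twisted_prism (k + 2))"
      using k by (intro finite_simple_graph_twisted_prism) simp
    have "v < 5 * (k + 2)"
      using v(1) M fsg by (fastforce simp: k_matching_def matching_def finite_simple_graph_def)
    then have "w div 5 = (v div 5 + j) mod (k + 2)" "v div 5 < k + 2"
      using v(2) funpow_turn(4)[where k = "k + 2" and v = v and j = j] less_mult_imp_div_less[of v "k + 2" 5]
      by (auto simp: mult.commute)
    then have "w div 5 < k" using shift s(2)[OF v(1)] by simp
    then show "w \<in> {..<5 * k}" by (auto simp: div_less_iff_less_mult)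
  qed
  have sub: "N \<subseteq> edges (twisted_prism (k + 2))"
    using N by (auto simp: k_matching_def matching_def)
  have "N \<subseteq> edges (twisted_prism k)"
  proof
    fix e assume "e \<in> N"
    show "e \<in> edges (twisted_prism k)"
    proof (rule edge_delete_slices(1))
      show "3 \<le> k" using k by simp
      show "e \<in> edges (twisted_prism (k + 2))" using sub \<open>e \<in> N\<close> by (rule subsetD)
      show "e \<subseteq> {..<5 * k}" using Union_upper[OF \<open>e \<in> N\<close>] free by (rule subset_trans)
    qed
  qed
  then have "k_matching 3 (twisted_prism k) N"
    using N by (auto simp: k_matching_def matching_def)
  then have "extends_to_perfect (twisted_prism k) N" by (rule IH)
  then have "extends_to_perfect (twisted_prism (k + 2)) N"
    using k sub free by (intro extends_insert_slices) auto
  then show ?thesis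
    using extends_rotate[OF _ M, of j] by (simp add: N_def)
qed

section \<open>Three-matchings of the prism with eight slices\<close>

fun meets :: "'a \<times> 'a \<Rightarrow> 'a \<times> 'a \<Rightarrow> bool" where
  "meets (a, b) (c, d) \<longleftrightarrow> a = c \<or> a = d \<or> b = c \<or> b = d"

text \<open>A certificate for the edge \<open>e\<close> stores a list of perfect matchings through \<open>e\<close>, transposed: the edges
  disjoint from \<open>e\<close> are listed as \<open>L\<close>, and bit \<open>i\<close> of the integer belonging to such an edge tells whether
  the \<open>i\<close>-th matching contains it. The middle condition says at once that the matchings are matchings
  (touching edges share no bit) and that any two disjoint edges are together in one of them (disjoint
  edges share a bit). The last condition says that every matching covers every vertex; \<open>m\<close> has one bit
  for each matching.\<close>
definition certifies ::
  "'a list \<Rightarrow> ('a \<times> 'a) list \<Rightarrow> 'a \<times> 'a \<Rightarrow> int \<Rightarrow> int list \<Rightarrow> bool" where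
  "certifies vs es e m rs \<longleftrightarrow>
     (let L = filter (\<lambda>f. \<not> meets e f) es; T = zip L rs in
        length rs = length L \<and>
        sorted_wrt (\<lambda>(f, r) (g, s). (and r s = 0) = meets f g) T \<and>
        (\<forall>v\<in>set vs. v = fst e \<or> v = snd e \<or>
           foldr or (map snd (filter (\<lambda>(f, r). v = fst f \<or> v = snd f) T)) 0 = m))"

definition pair_graph :: "'a list \<Rightarrow> ('a \<times> 'a) list \<Rightarrow> 'a graph" where
  "pair_graph vs es = (set vs, (\<lambda>(a, b). {a, b}) ` set es)"

lemma bit_foldr_or: "bit (foldr or rs (0::int)) i \<longleftrightarrow> (\<exists>r\<in>set rs. bit r i)"
  by (induction rs) (auto simp: bit_or_iff)

lemma meets_iff: "meets f g \<longleftrightarrow> {fst f, snd f} \<inter> {fst g, snd g} \<noteq> {}"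
  by (cases f; cases g) auto

text \<open>A bit \<open>i\<close> common to the integers of \<open>f\<close> and \<open>g\<close> selects the matching. It is a bit of the integer
  \<open>m\<close>, since \<open>m\<close> is the disjunction at an endpoint of \<open>f\<close>; as \<open>m\<close> is the same at all vertices, the matching
  selected by \<open>i\<close> is perfect.\<close>
lemma certifies_extends:
  assumes cert: "certifies vs es e m rs"
    and es: "\<And>a b. (a, b) \<in> set es \<Longrightarrow> a \<in> set vs \<and> b \<in> set vs"
    and e: "e \<in> set es" and fg: "f \<in> set es" "g \<in> set es"
    and disj: "\<not> meets e f" "\<not> meets e g" "\<not> meets f g"
  shows "extends_to_perfect (pair_graph vs es)
           {{fst e, snd e}, {fst f, snd f}, {fst g, snd g}}"
proof -
  define L where "L = filter (\<lambda>f. \<not> meets e f) es"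
  define T where "T = zip L rs"
  have len: "length rs = length L"
    and sorted: "sorted_wrt (\<lambda>(f, r) (g, s). (and r s = 0) = meets f g) T"
    and cover: "\<And>v. v \<in> set vs \<Longrightarrow> v = fst e \<or> v = snd e \<or>
      foldr or (map snd (filter (\<lambda>(f, r). v = fst f \<or> v = snd f) T)) 0 = m"
    using cert unfolding certifies_def Let_def L_def[symmetric] T_def[symmetric] by blast+
  have T_L: "h \<in> set L" if "(h, r) \<in> set T" for h r
    using that by (auto simp: T_def dest: set_zip_leftD)
  have L_T: "\<exists>r. (h, r) \<in> set T" if "h \<in> set L" for h
    using that len unfolding T_def by (metis in_set_impl_in_set_zip1)
  have L: "h \<in> set L \<longleftrightarrow> h \<in> set es \<and> \<not> meets e h" for h by (simp add: L_def)
  have rel: "(and r s = 0) = meets h h'"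
    if "(h, r) \<in> set T" "(h', s) \<in> set T" "(h, r) \<noteq> (h', s)" for h h' r s
  proof -
    obtain i j where ij: "i < length T" "j < length T" "T ! i = (h, r)" "T ! j = (h', s)"
      using \<open>(h, r) \<in> set T\<close> \<open>(h', s) \<in> set T\<close> by (metis in_set_conv_nth)
    then have "i < j \<or> j < i" using that(3) by (metis linorder_neqE_nat)
    then show ?thesis
      using sorted_wrt_nth_less[OF sorted, of i j] sorted_wrt_nth_less[OF sorted, of j i] ij
      by (auto simp: and.commute meets_iff)
  qed
  obtain r s where inT: "(f, r) \<in> set T" "(g, s) \<in> set T"
    using L_T L fg disj by meson
  have "(f, r) \<noteq> (g, s)" using disj(3) by (auto simp: meets_iff)
  then have "and r s \<noteq> 0" using rel[OF inT] disj(3) by simp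
  then obtain i where i: "bit r i" "bit s i"
    by (metis bit_and_iff bit_0_eq bot_apply bot_bool_def bit_eqI)
  define P where "P = insert {fst e, snd e} {{fst h, snd h} |h r. (h, r) \<in> set T \<and> bit r i}"
  have P: "p = {fst e, snd e} \<or> (\<exists>h r. (h, r) \<in> set T \<and> bit r i \<and> p = {fst h, snd h})"
    if "p \<in> P" for p using that unfolding P_def by blast
  have "pairwise disjnt P"
  proof (rule pairwiseI)
    have ee: "disjnt {fst e, snd e} {fst h, snd h}" if "(h, r) \<in> set T" for h r
      using T_L[OF that] unfolding L meets_iff disjnt_def by simp
    have hh: "disjnt {fst h, snd h} {fst h', snd h'}"
      if "(h, r) \<in> set T" "bit r i" "(h', s) \<in> set T" "bit s i" "{fst h, snd h} \<noteq> {fst h', snd h'}"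
      for h r h' s
    proof -
      have "bit (and r s) i" using that by (simp add: bit_and_iff)
      then have "and r s \<noteq> 0" by auto
      then have "\<not> meets h h'" using rel[OF that(1,3)] that(5) by auto
      then show ?thesis unfolding meets_iff disjnt_def by simp
    qed
    fix p q assume pq: "p \<in> P" "q \<in> P" "p \<noteq> q"
    show "disjnt p q"
      using P[OF pq(1)] P[OF pq(2)] pq(3) ee hh by (metis disjnt_sym)
  qed
  moreover have "\<Union>P = set vs"
  proof
    have "{fst h, snd h} \<subseteq> set vs" if "h \<in> set es" for h
      using es[of "fst h" "snd h"] that by simp
    then show "\<Union>P \<subseteq> set vs" using P e T_L L by blast
    show "set vs \<subseteq> \<Union>P"
    proof
      fix v assume v: "v \<in> set vs"
      have "fst f \<in> set vs" "fst f \<noteq> fst e" "fst f \<noteq> snd e"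
        using fg(1) es[of "fst f" "snd f"] disj(1) by (auto simp: meets_iff)
      then have "foldr or (map snd (filter (\<lambda>(h, r). fst f = fst h \<or> fst f = snd h) T)) 0 = m"
        using cover[of "fst f"] by simp
      moreover have "bit (foldr or (map snd (filter (\<lambda>(h, r). fst f = fst h \<or> fst f = snd h) T)) 0) i"
      proof -
        have "(f, r) \<in> set (filter (\<lambda>(h, r). fst f = fst h \<or> fst f = snd h) T)"
          using inT(1) by simp
        then have "r \<in> set (map snd (filter (\<lambda>(h, r). fst f = fst h \<or> fst f = snd h) T))"
          unfolding set_map by (rule rev_image_eqI) simp
        then show ?thesis unfolding bit_foldr_or using i(1) by (rule rev_bexI)
      qed
      ultimately have "bit m i" by simp
      show "v \<in> \<Union>P"
      proof (cases "v = fst e \<or> v = snd e")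
        case True
        then show ?thesis by (auto simp: P_def)
      next
        case False
        then have "bit (foldr or (map snd (filter (\<lambda>(h, r). v = fst h \<or> v = snd h) T)) 0) i"
          using cover[OF v] \<open>bit m i\<close> by simp
        then obtain h r where "(h, r) \<in> set T" "bit r i" "v = fst h \<or> v = snd h"
          unfolding bit_foldr_or by auto
        then show ?thesis unfolding P_def by blast
      qed
    qed
  qed
  moreover have "P \<subseteq> edges (pair_graph vs es)"
  proof
    have "{fst h, snd h} \<in> edges (pair_graph vs es)" if "h \<in> set es" for h
      using that by (force simp: pair_graph_def case_prod_beta)
    moreover fix p assume "p \<in> P"
    ultimately show "p \<in> edges (pair_graph vs es)" using P[of p] e T_L L by metis
  qed
  moreover have "{{fst e, snd e}, {fst f, snd f}, {fst g, snd g}} \<subseteq> P"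
    using inT i unfolding P_def by blast
  ultimately show ?thesis
    unfolding extends_to_perfect_def perfect_matching_def matching_def
    by (intro exI[of _ P]) (simp add: pair_graph_def)
qed

definition edge_list :: "nat \<Rightarrow> (nat \<times> nat) list" where
  "edge_list k = map (\<lambda>v. (v, up v)) [0..<5 * k] @ map (\<lambda>v. (v, turn k v)) [0..<5 * k]"

lemma pair_graph_edge_list: "pair_graph [0..<5 * k] (edge_list k) = twisted_prism k"
proof -
  have "edges (pair_graph [0..<5 * k] (edge_list k)) = edges (twisted_prism k)"
    by (simp add: pair_graph_def twisted_prism_def edge_list_def image_Un image_image atLeast_upt)
  then show ?thesis by (simp add: pair_graph_def twisted_prism_def atLeast_upt)
qed

text \<open>The matchings in the six certificates were found by a randomized greedy search. The six edges
  represent the orbits of the rotation on the edges of \<open>twisted_prism 8\<close>: eight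
  turns amount to the reflection, up to which there are three edges in a pentagon and three edges between
  two slices.\<close>
lemma certificate_0_1:
  "certifies [0..<40] (edge_list 8) (0, 1) 70368744177663
    [1170455037073, 26393251480392, 35952382352041, 32165597552658, 70944556676, 18795987048,
     27767047479556, 18217109164545, 5636658307224, 311399815236, 70348178466, 9208485955596,
     19894457680961, 4965003174280, 416109430789, 8864838779952, 414532014090, 35296060424225,
     29154276346242, 4401603559969, 8821888648216, 20892936642754, 52867293676066,
     9347025410177, 5542667927856, 46180631708682, 1651441221828, 53623343056514, 1149317153,
     148750994692, 50337087357090, 209421615432, 2375255360641, 17601321829122, 2487491649,
     1271445192864, 66893691251546, 2372302624872, 5265915140098, 6846488939651, 6649314346066,
     2250764272964, 35759899443457, 65013088493841, 35736411771408, 36293834711456,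
     44264212432930, 28660786611746, 4973907690120, 25353498272193, 13765919771156,
     1245070889492, 36326844960848, 56113888276802, 35735875111428, 413827339528,
     4673336517704, 486019310604, 1031363692676, 4918043775265, 15436181940241, 3481088573716,
     54993031529026, 17614080848449, 17618627471888, 1099797565476, 13263163230280,
     15225812336792, 2268824977432, 2203607733253, 37129003757620, 37539122520100,
     66825986515718]"
  by code_simp

lemma certificate_1_2:
  "certifies [0..<40] (edge_list 8) (1, 2) 70368744177663
    [1276184301953, 18420314196080, 19792309420097, 44436711306534, 1670760138881,
     17738762371394, 1172799230512, 37393206248481, 9105633722626, 708672004257, 9904207249428,
     17516991048, 35476568425512, 4470331769474, 554086457353, 1159712670340, 10998607779905,
     4879100297384, 35186934850052, 6052735159306, 9194578689, 56132140013634, 36223893143944,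
     11034082805780, 1100738527778, 40411456875537, 2217277149698, 2285463766280, 10001713170,
     3337342239237, 4399457895568, 44669842510339, 19931449384, 1100858138897, 6773164278788,
     9908442551193, 57896197424194, 39780759184522, 15463229432884, 43997847363596,
     9622876342532, 6139723451032, 24261272732248, 35495992234504, 7459335212161,
     23335144595602, 17730180755524, 36293165718532, 24259872689474, 52987684725026,
     558423376644, 12691663227153, 29051160232304, 44395072360496, 5222739002392,
     8799080490001, 17611045803074, 77913936001, 19911742079172, 9004670582948, 23128493394020,
     5499722424865, 58156008908104, 8944806695176, 18735339569480, 284944507024,
     62573556273348, 8865391317152, 53687137347682, 2564104202276, 12167670797061,
     6674398316034, 53629330442826]"
  by code_simp

lemma certificate_2_3:
  "certifies [0..<40] (edge_list 8) (2, 3) 281474976710655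
    [145415918608389, 63445818967586, 6614385451017, 19002017516036, 2833495528715,
     9105431339568, 54096203972738, 22078318223425, 1142889842700, 3030103917570,
     8873772720680, 71473759338514, 22542183202836, 1146974438472, 49357776928932,
     1104176744962, 211193340380449, 35872682574104, 32160870368804, 605599961217,
     40957045147938, 17695287809156, 17799453902472, 9345870399521, 146550768546946,
     2207750588456, 44840067338258, 2207647433346, 9523087612993, 5500243058848,
     143258639419922, 35751912083496, 36850828345922, 13331985470468, 91868882643697,
     180672098615554, 4882444324, 70405289154640, 114566965137762, 74769348841548,
     150359098132260, 141291608605840, 259639463665904, 269536049842372, 143503992556801,
     37563801016456, 116962160038690, 17662519284481, 35050230033, 57623452094660,
     10175652110914, 140823659030657, 213307706058770, 230977972806728, 11554007490584,
     217731354216481, 72617764737090, 35400800321864, 8934358794772, 211268636262977,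
     1104101253444, 181711887671572, 90177537442324, 123782098780481, 23158522520964,
     242411315940369, 88032353992744, 176274108596490, 8933995451404, 79305902686273,
     2207949980040, 143259808901521, 21492092964504]"
  by code_simp

lemma certificate_0_5:
  "certifies [0..<40] (edge_list 8) (0, 5) 17592186044415
    [13817078694289, 2233922355752, 4741812795457, 4411116569761, 2543159739208, 1108701187,
     17652670632, 4412047101504, 275417403660, 1649536345090, 2352580956945, 10880573480,
     9626096768592, 4432417267972, 9631883662360, 2340828873473, 10042314073097, 275969278512,
     7269376861316, 421193077000, 2755293020708, 11012506059800, 4880744325762, 577809712164,
     6670369450248, 690421269124, 652910625864, 8958916448898, 4475423326532, 2771349154825,
     8935714324880, 668682196257, 1254269454912, 6700753227916, 572313962753, 10033146699992,
     1290447268428, 20745033732, 1804226528388, 4053120223028, 11890622206226, 10617164701714,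
     13243691075632, 13537957120200, 15221952416838, 1271864066053, 2287556837537,
     2423541220033, 52111622180, 18524180624, 6683344636290, 1246115170314, 1104343894050,
     5567361886402, 4776054769986, 590558056516, 8800724734273, 8797272212049, 8848338060305,
     1113203945505, 1108377602337, 3332907272216, 1546734669954, 1383057264738, 6890357148166,
     6871981367316, 824938996769, 8798678893104, 4502065299972, 8797253025930, 8812224364818,
     1520439960642, 2484660081698]"
  by code_simp

lemma certificate_1_6:
  "certifies [0..<40] (edge_list 8) (1, 6) 8796093022207
    [6794917187089, 1100723802372, 7456072895491, 5670567183890, 25782415364, 7151390263570,
     774324095636, 5778979693834, 172470878724, 4967175889048, 2211977527616, 1168316041236,
     4679501096066, 2199871064588, 4434692218960, 3169696646529, 1383055312930, 4471614645380,
     276256264722, 4511876056132, 2336733798785, 284541872136, 6116675191682, 326704910353,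
     4606386373700, 1155688104353, 1143870873752, 344274895618, 5499789873161, 172234916944,
     4745943613729, 34435907714, 1444860200204, 4546291044865, 38982403352, 7087909282401,
     235407958756, 350695878956, 896139329704, 71507116232, 1409294799881, 2774829959361,
     2203604093249, 1547413227041, 4400496599074, 2242789232737, 69812490288, 1452842161186,
     69526378502, 57583735368, 705486652168, 1846908371265, 708687577473, 1122177778216,
     5018720175124, 2235936411729, 2201313740840, 3299273123880, 825305389074, 2337142870594,
     158939546660, 151399179332, 563728614274, 2208713155080, 569135664132, 7149007706177,
     2800629074096, 2560339617828, 1669201336454, 1104612167960, 167789208112, 4312703042,
     1650479956162]"
  by code_simp

lemma certificate_2_7:
  "certifies [0..<40] (edge_list 8) (2, 7) 8796093022207
    [206177618435, 962884297745, 1123143520520, 2267761664522, 554323946513, 1237496234336,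
     1169334214914, 842184884904, 4481804021829, 584165951760, 6735046018596, 6462361315874,
     69056168008, 287796765188, 4605281896504, 2216354288644, 552205824034, 1168374810692,
     2612783154690, 21484306608, 6743253978184, 3508019489, 86075524228, 278170538017,
     2800999203664, 4535523346568, 275231424548, 83383289097, 294209753136, 6665790882369,
     1152699607192, 1138452747276, 833796210945, 6822829626450, 1378735473313, 95634589714,
     4442410189844, 1955800486324, 6728193642950, 6640069870212, 848424933505, 4572530871361,
     1513575432744, 364202971146, 43287855192, 2212043051028, 3472104115474, 2216547615874,
     1112678080705, 74089562497, 52632487297, 4967135973537, 1686466744641, 861778756354,
     1426543657492, 7022879900184, 47799083288, 4475358816268, 1169575981061, 2830517998658,
     1683629578306, 8384047876674, 1241564464258, 289994490914, 4537643991809, 6753848730256,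
     34452103300, 594527922444, 687608041732, 3024361693408, 69995333730, 1105015081512,
     6634114917448]"
  by code_simp

text \<open>Here \<open>reaches R n e\<close> follows \<open>e\<close> through fewer than \<open>n\<close> rotations of \<open>twisted_prism 8\<close> until it
  becomes, up to orientation, an edge in \<open>R\<close>.\<close>
primrec reaches :: "(nat \<times> nat) list \<Rightarrow> nat \<Rightarrow> nat \<times> nat \<Rightarrow> bool" where
  "reaches R 0 e \<longleftrightarrow> False"
| "reaches R (Suc n) e \<longleftrightarrow>
     (if e \<in> set R \<or> prod.swap e \<in> set R then True
      else reaches R n (map_prod (turn 8) (turn 8) e))"

lemma reaches_funpow:
  assumes "reaches R n e"
  obtains j f where "f \<in> set R" "(turn 8 ^^ j) ` {fst e, snd e} = {fst f, snd f}"
proof -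
  have "\<exists>j. \<exists>f\<in>set R. (turn 8 ^^ j) ` {fst e, snd e} = {fst f, snd f}"
    using assms
  proof (induction n arbitrary: e)
    case (Suc n)
    show ?case
    proof (cases "e \<in> set R \<or> prod.swap e \<in> set R")
      case True
      moreover have "{fst e, snd e} = {fst (prod.swap e), snd (prod.swap e)}"
        by (simp add: insert_commute)
      ultimately show ?thesis by (metis funpow_0 image_ident image_cong)
    next
      case False
      then obtain j f where "f \<in> set R"
        "(turn 8 ^^ j) ` {turn 8 (fst e), turn 8 (snd e)} = {fst f, snd f}"
        using Suc.IH[of "map_prod (turn 8) (turn 8) e"] Suc.prems by auto
      then show ?thesis by (intro exI[of _ "Suc j"] bexI[of _ f])
        (simp_all add: funpow_Suc_right del: funpow.simps)
    qed
  qed simp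
  then show thesis using that by blast
qed

lemma edges_reach:
  "list_all (reaches [(0, 1), (1, 2), (2, 3), (0, 5), (1, 6), (2, 7)] 16) (edge_list 8)"
  by code_simp

lemma extends_8:
  assumes M: "k_matching 3 (twisted_prism 8) M"
  shows "extends_to_perfect (twisted_prism 8) M"
proof -
  let ?R = "[(0, 1), (1, 2), (2, 3), (0, 5), (1, 6), (2, 7)] :: (nat \<times> nat) list"
  let ?G = "pair_graph [0..<40] (edge_list 8)"
  have G: "?G = twisted_prism 8" using pair_graph_edge_list[of 8] by simp
  have edge: "\<exists>f\<in>set (edge_list 8). d = {fst f, snd f}" if "d \<in> edges (twisted_prism 8)" for d
    using that unfolding G[symmetric] by (force simp: pair_graph_def)
  obtain p q r where pqr: "M = {p, q, r}" "p \<noteq> q" "p \<noteq> r" "q \<noteq> r"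
    using M by (auto simp: k_matching_def card_3_iff)
  obtain f0 where f0: "f0 \<in> set (edge_list 8)" "p = {fst f0, snd f0}"
    using edge[of p] M pqr by (auto simp: k_matching_def matching_def)
  obtain j e where j: "e \<in> set ?R" "(turn 8 ^^ j) ` p = {fst e, snd e}"
    using edges_reach f0 reaches_funpow[of ?R 16 f0] unfolding list_all_iff by metis
  define N where "N = (`) (turn 8 ^^ j) ` M"
  have N: "k_matching 3 (twisted_prism 8) N"
    unfolding N_def using M by (intro k_matching_rotate) auto
  have Neq: "N = {{fst e, snd e}, (turn 8 ^^ j) ` q, (turn 8 ^^ j) ` r}"
    using j(2) by (simp add: N_def pqr(1))
  have "card N = 3" using N by (simp add: k_matching_def)
  then have distinct: "{fst e, snd e} \<noteq> (turn 8 ^^ j) ` q" "{fst e, snd e} \<noteq> (turn 8 ^^ j) ` r"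
    "(turn 8 ^^ j) ` q \<noteq> (turn 8 ^^ j) ` r"
    unfolding Neq by (simp_all add: card_insert_if split: if_splits)
  have Nsub: "N \<subseteq> edges (twisted_prism 8)" and Ndisj: "pairwise disjnt N"
    using N by (simp_all add: k_matching_def matching_def)
  have qr: "(turn 8 ^^ j) ` q \<in> edges (twisted_prism 8)" "(turn 8 ^^ j) ` r \<in> edges (twisted_prism 8)"
    using Nsub by (simp_all add: Neq)
  obtain f where f: "f \<in> set (edge_list 8)" "(turn 8 ^^ j) ` q = {fst f, snd f}"
    using edge[OF qr(1)] by blast
  obtain g where g: "g \<in> set (edge_list 8)" "(turn 8 ^^ j) ` r = {fst g, snd g}"
    using edge[OF qr(2)] by blast
  have "e \<in> set (edge_list 8)" using j(1) by (auto simp: edge_list_def up_def turn_def)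
  moreover have "\<not> meets e f" "\<not> meets e g" "\<not> meets f g"
    using pairwiseD[OF Ndisj, of "{fst e, snd e}" "{fst f, snd f}"]
      pairwiseD[OF Ndisj, of "{fst e, snd e}" "{fst g, snd g}"]
      pairwiseD[OF Ndisj, of "{fst f, snd f}" "{fst g, snd g}"] distinct
    unfolding Neq f(2) g(2) meets_iff disjnt_def by simp_all
  moreover obtain m rs where "certifies [0..<40] (edge_list 8) e m rs"
    using j(1) certificate_0_1 certificate_1_2 certificate_2_3 certificate_0_5 certificate_1_6
      certificate_2_7 by auto
  moreover have "a \<in> set [0..<40] \<and> b \<in> set [0..<40]" if "(a, b) \<in> set (edge_list 8)" for a b
    using that up_less[of _ 8] turn_less[of 8] by (auto simp: edge_list_def)
  ultimately have "extends_to_perfect ?G {{fst e, snd e}, {fst f, snd f}, {fst g, snd g}}"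
    using f(1) g(1) by (intro certifies_extends) auto
  then have "extends_to_perfect (twisted_prism 8) N" by (simp add: G Neq f(2) g(2))
  then show ?thesis using extends_rotate[OF _ M, of j] by (simp add: N_def)
qed

lemma twisted_prism_extends_3_matching:
  "k_matching 3 (twisted_prism (8 + 2 * n)) M \<Longrightarrow> extends_to_perfect (twisted_prism (8 + 2 * n)) M"
proof (induction n arbitrary: M)
  case 0
  then show ?case using extends_8 by simp
next
  case (Suc n)
  have "8 + 2 * Suc n = 8 + 2 * n + 2" by simp
  then show ?case using Suc extends_step[of "8 + 2 * n" M] by simp
qed

section \<open>The Klein bottle as a glued cylinder\<close>

text \<open>The cylinder \<open>\<real> \<times> (\<real> / 2\<pi>)\<close> modulo \<open>(x, y) \<mapsto> (x + \<pi>, - y)\<close> is the Klein bottle as a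
  circle bundle glued by a reflection. These three coordinates are invariant under the gluing and
  separate its orbits. The model has the advantage over a quotient that it is visibly Hausdorff
  and that continuity into it is elementary.\<close>
definition klein_point :: "real \<Rightarrow> real \<Rightarrow> complex \<times> complex \<times> real" where
  "klein_point x y = (cis (2 * x), cis x * complex_of_real (sin y), cos y)"

definition klein_surface :: "(complex \<times> complex \<times> real) set" where
  "klein_surface = range (\<lambda>(x, y). klein_point x y)"

lemma klein_point_shift:
  "klein_point (x + pi) y = klein_point x (- y)" "klein_point x (y + 2 * pi) = klein_point x y"
proof -
  have "cis (2 * x + 2 * pi) = cis (2 * x)" by (simp add: complex_eq_iff)
  moreover have "cis (x + pi) = - cis x" by (simp add: complex_eq_iff)
  ultimately show "klein_point (x + pi) y = klein_point x (- y)"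
    "klein_point x (y + 2 * pi) = klein_point x y"
    by (simp_all add: klein_point_def distrib_left)
qed

lemma klein_point_inj:
  assumes eq: "klein_point x y = klein_point x' y'" and "\<bar>x - x'\<bar> < pi" "\<bar>y - y'\<bar> < 2 * pi"
  shows "x = x' \<and> y = y'"
proof -
  have aux: "a = b" if ab: "sin a = sin b" "cos a = cos b" "\<bar>a - b\<bar> < 2 * pi" for a b :: real
  proof -
    obtain n :: int where n: "a = b + 2 * pi * n" using sin_cos_eq_iff[of a b] ab by blast
    then have "\<bar>2 * pi * n\<bar> < 2 * pi" using ab(3) by simp
    then have "\<bar>real_of_int n\<bar> < 1" by (simp add: abs_mult)
    then have "n = 0" by linarith
    then show ?thesis using n by simp
  qed
  have c: "cis (2 * x) = cis (2 * x')" "cis x * complex_of_real (sin y) = cis x' * complex_of_real (sin y')"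
    "cos y = cos y'"
    using eq by (auto simp: klein_point_def)
  have "sin (2 * x) = sin (2 * x')" "cos (2 * x) = cos (2 * x')"
    using arg_cong[OF c(1), of Im] arg_cong[OF c(1), of Re] by simp_all
  moreover have "\<bar>2 * x - 2 * x'\<bar> < 2 * pi" using assms(2) by linarith
  ultimately have "2 * x = 2 * x'" by (rule aux)
  then have x: "x = x'" by simp
  then have "sin y = sin y'" using c(2) by simp
  then show ?thesis using aux[of y y'] c(3) assms(3) x by simp
qed

lemma continuous_on_klein_point:
  "continuous_on S (\<lambda>p. klein_point (fst p) (snd p))"
  unfolding klein_point_def by (intro continuous_intros continuous_on_cis)

text \<open>In the punctured sphere, \<open>t\<close> corresponds to \<open>cos y / 2\<close> and the argument of \<open>z\<close> to \<open>x\<close>. The factor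
  \<open>sqrt (1 - 4 * t\<^sup>2)\<close>, which is \<open>\<bar>sin y\<bar>\<close>, vanishes exactly on the two boundary circles, so only
  \<open>z\<^sup>2\<close> is remembered there: this is the antipodal identification of the cross-caps.\<close>
definition unroll :: "complex \<times> real \<Rightarrow> complex \<times> complex \<times> real" where
  "unroll = (\<lambda>(z, t). (z\<^sup>2 / of_real (1 - t\<^sup>2),
     z / of_real (sqrt (1 - t\<^sup>2)) * of_real (sqrt (1 - 4 * t\<^sup>2)), 2 * t))"

lemma punctured_sphere_iff:
  "(z, t) \<in> punctured_sphere \<longleftrightarrow> (\<exists>x. z = of_real (sqrt (1 - t\<^sup>2)) * cis x) \<and> \<bar>t\<bar> \<le> 1/2"
proof -
  have "norm (z, t) = 1 \<longleftrightarrow> (cmod z)\<^sup>2 = 1 - t\<^sup>2"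
    by (simp add: norm_Pair) (auto simp: algebra_simps)
  moreover have "(cmod z)\<^sup>2 = 1 - t\<^sup>2 \<longleftrightarrow> cmod z = sqrt (1 - t\<^sup>2)" if "\<bar>t\<bar> \<le> 1/2"
  proof -
    have "t\<^sup>2 \<le> 1" using that by (simp add: abs_square_le_1)
    then show ?thesis by (metis diff_ge_0_iff_ge norm_ge_zero real_sqrt_pow2 real_sqrt_unique)
  qed
  moreover have "cmod z = sqrt (1 - t\<^sup>2) \<longleftrightarrow> (\<exists>x. z = of_real (sqrt (1 - t\<^sup>2)) * cis x)" if "\<bar>t\<bar> \<le> 1/2"
  proof -
    have "t\<^sup>2 \<le> 1" using that by (simp add: abs_square_le_1)
    then show ?thesis
      by (metis norm_cis norm_mult norm_of_real mult.right_neutral abs_of_nonneg real_sqrt_ge_zero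
          diff_ge_0_iff_ge rcis_cmod_Arg rcis_def)
  qed
  ultimately show ?thesis by (auto simp: punctured_sphere_def)
qed

lemma unroll_polar:
  assumes "\<bar>t\<bar> \<le> 1/2"
  shows "unroll (of_real (sqrt (1 - t\<^sup>2)) * cis x, t) = (cis (2 * x), cis x * of_real (sqrt (1 - 4 * t\<^sup>2)), 2 * t)"
proof -
  have "t\<^sup>2 < 1" using assms by (simp add: abs_square_less_1)
  then have "complex_of_real (sqrt (1 - t\<^sup>2)) \<noteq> 0" "(complex_of_real (sqrt (1 - t\<^sup>2)))\<^sup>2 = of_real (1 - t\<^sup>2)"
    "complex_of_real (1 - t\<^sup>2) \<noteq> 0"
    by (simp_all flip: of_real_power)
  then show ?thesis by (simp add: unroll_def power_mult_distrib Complex.DeMoivre)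
qed

lemma unroll_image: "unroll ` punctured_sphere = klein_surface"
proof
  show "unroll ` punctured_sphere \<subseteq> klein_surface"
  proof
    fix p assume "p \<in> unroll ` punctured_sphere"
    then obtain t x where t: "\<bar>t\<bar> \<le> 1/2" and p: "p = (cis (2 * x), cis x * of_real (sqrt (1 - 4 * t\<^sup>2)), 2 * t)"
      using unroll_polar by (force simp: punctured_sphere_iff)
    have "p = klein_point x (arccos (2 * t))"
      using t by (simp add: p klein_point_def sin_arccos_abs power_mult_distrib)
    then show "p \<in> klein_surface" by (auto simp: klein_surface_def)
  qed
  show "klein_surface \<subseteq> unroll ` punctured_sphere"
  proof
    fix p assume "p \<in> klein_surface"
    then obtain x y where p: "p = klein_point x y" by (auto simp: klein_surface_def)
    \<comment> \<open>The two preimages \<open>(x, y)\<close> and \<open>(x - \<pi>, - y)\<close> have opposite values of \<open>sin y\<close>;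
      \<open>unroll\<close> yields the nonnegative one.\<close>
    obtain x' y' where p': "p = klein_point x' y'" "0 \<le> sin y'"
    proof (cases "0 \<le> sin y")
      case False
      then show thesis
        using p klein_point_shift(1)[of "x - pi" y] by (intro that[of "x - pi" "- y"]) simp_all
    qed (use p that in blast)
    define t where "t = cos y' / 2"
    have t: "\<bar>t\<bar> \<le> 1/2" by (simp add: t_def)
    have "sqrt (1 - 4 * t\<^sup>2) = sin y'"
      using p'(2) by (simp add: t_def power_divide sin_squared_eq[symmetric])
    then have "p = unroll (of_real (sqrt (1 - t\<^sup>2)) * cis x', t)"
      unfolding unroll_polar[OF t] by (simp add: p' klein_point_def) (simp add: t_def)
    moreover have "(of_real (sqrt (1 - t\<^sup>2)) * cis x', t) \<in> punctured_sphere"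
      using t unfolding punctured_sphere_iff by blast
    ultimately show "p \<in> unroll ` punctured_sphere" by blast
  qed
qed

lemma unroll_eq_iff:
  assumes "p \<in> punctured_sphere" "q \<in> punctured_sphere"
  shows "unroll p = unroll q \<longleftrightarrow> (p, q) \<in> crosscap_rel"
proof -
  obtain z t where p: "p = (z, t)" by force
  obtain w s where q: "q = (w, s)" by force
  have t: "\<bar>t\<bar> \<le> 1/2" using assms(1) by (simp add: p punctured_sphere_iff)
  then have "t\<^sup>2 < 1" by (simp add: abs_square_less_1)
  then have pos: "complex_of_real (1 - t\<^sup>2) \<noteq> 0" "complex_of_real (sqrt (1 - t\<^sup>2)) \<noteq> 0"
    by (simp_all flip: of_real_diff of_real_power)
  have "sqrt (1 - 4 * t\<^sup>2) = 0 \<longleftrightarrow> \<bar>t\<bar> = 1/2"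
  proof -
    have "sqrt (1 - 4 * t\<^sup>2) = 0 \<longleftrightarrow> (2 * t)\<^sup>2 = 1" by (auto simp: power_mult_distrib)
    also have "\<dots> \<longleftrightarrow> \<bar>2 * t\<bar> = 1" by (rule abs_square_eq_1)
    finally show ?thesis by (simp add: abs_mult) linarith
  qed
  then show ?thesis
    using assms pos unfolding p q unroll_def crosscap_rel_def
    by (auto simp: power2_eq_iff)
qed

lemma compact_punctured_sphere: "compact punctured_sphere"
proof -
  have "punctured_sphere = sphere 0 1 \<inter> (UNIV \<times> {-1/2..1/2})"
    by (auto simp: punctured_sphere_def abs_le_iff)
  moreover have "compact (sphere (0 :: complex \<times> real) 1 \<inter> (UNIV \<times> {-1/2..1/2}))"
    by (intro compact_Int_closed compact_sphere closed_Times closed_UNIV closed_atLeastAtMost)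
  ultimately show ?thesis by (simp only:)
qed

text \<open>Both \<open>unroll\<close> and the canonical projection are quotient maps of the punctured sphere with the same
  fibres.\<close>
lemma klein_bottle_homeomorphic:
  obtains h where "homeomorphic_map (top_of_set klein_surface) klein_bottle h"
proof -
  let ?q = "\<lambda>x. crosscap_rel `` {x}"
  have "continuous_on punctured_sphere unroll"
  proof -
    have "1 - t\<^sup>2 \<noteq> 0" "sqrt (1 - t\<^sup>2) \<noteq> 0" if "(z, t) \<in> punctured_sphere" for z :: complex and t
    proof -
      have "t\<^sup>2 < 1" using that by (simp add: abs_square_less_1 punctured_sphere_iff)
      then show "1 - t\<^sup>2 \<noteq> 0" "sqrt (1 - t\<^sup>2) \<noteq> 0" by auto
    qed
    then show ?thesis
      unfolding unroll_def case_prod_beta by (intro continuous_intros) (auto simp del: of_real_diff)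
  qed
  then have "continuous_map (top_of_set punctured_sphere) (top_of_set klein_surface) unroll"
    using unroll_image by auto
  then have unroll: "quotient_map (top_of_set punctured_sphere) (top_of_set klein_surface) unroll"
    using compact_punctured_sphere unroll_image
    by (intro continuous_imp_quotient_map) (auto simp: compact_space_subtopology Hausdorff_space_subtopology)
  have q: "quotient_map (top_of_set punctured_sphere) klein_bottle ?q"
    unfolding klein_bottle_def
    by (rule quotient_map_quotient_topology) (simp add: equiv_crosscap_rel)
  have eq: "unroll x = unroll y \<longleftrightarrow> ?q x = ?q y" if "x \<in> punctured_sphere" "y \<in> punctured_sphere" for x y
    using unroll_eq_iff[OF that] eq_equiv_class_iff[OF equiv_crosscap_rel that] by (simp only:)
  obtain g where g: "continuous_map (top_of_set klein_surface) klein_bottle g"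
    "\<And>x. x \<in> punctured_sphere \<Longrightarrow> g (unroll x) = ?q x"
  proof (rule quotient_map_lift_exists[OF unroll quotient_imp_continuous_map[OF q]])
    show "?q x = ?q y" if "x \<in> topspace (top_of_set punctured_sphere)"
      "y \<in> topspace (top_of_set punctured_sphere)" "unroll x = unroll y" for x y
      using eq[of x y] that by simp
  qed (use that in simp)
  obtain g' where g': "continuous_map klein_bottle (top_of_set klein_surface) g'"
    "\<And>x. x \<in> punctured_sphere \<Longrightarrow> g' (?q x) = unroll x"
  proof (rule quotient_map_lift_exists[OF q quotient_imp_continuous_map[OF unroll]])
    show "unroll x = unroll y" if "x \<in> topspace (top_of_set punctured_sphere)"
      "y \<in> topspace (top_of_set punctured_sphere)" "?q x = ?q y" for x y
      using eq[of x y] that by simp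
  qed (use that in simp)
  have "homeomorphic_maps (top_of_set klein_surface) klein_bottle g g'"
    unfolding homeomorphic_maps_def
  proof (intro conjI ballI)
    fix x assume "x \<in> topspace (top_of_set klein_surface)"
    then have "x \<in> unroll ` punctured_sphere" by (simp add: unroll_image)
    then obtain p where "p \<in> punctured_sphere" "x = unroll p" by blast
    then show "g' (g x) = x" using g(2) g'(2) by simp
  next
    fix y assume "y \<in> topspace klein_bottle"
    then obtain x where "x \<in> punctured_sphere" "y = ?q x"
      by (auto simp: topspace_klein_bottle elim: quotientE)
    then show "g (g' y) = y" using g(2) g'(2) by simp
  qed (use g g' in auto)
  then show thesis using that homeomorphic_maps_map by blast
qed

section \<open>Drawing a twisted prism as a grid\<close>

text \<open>Being finitely many, the closed parts are also open.\<close>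
lemma components_of_closed_partition:
  assumes "finite \<C>" "\<And>C. C \<in> \<C> \<Longrightarrow> closedin Y C" "\<And>C. C \<in> \<C> \<Longrightarrow> connectedin Y C"
    and "pairwise disjnt \<C>" "\<Union>\<C> = topspace Y"
  shows "connected_components_of Y \<subseteq> \<C>"
proof
  fix F assume F: "F \<in> connected_components_of Y"
  then obtain x where x: "x \<in> F" using nonempty_connected_components_of by blast
  then have "x \<in> topspace Y" using connected_components_of_subset[OF F] by blast
  then obtain C where C: "C \<in> \<C>" "x \<in> C" using assms(5) by blast
  have "topspace Y - C = \<Union>(\<C> - {C})"
    using assms(4) C(1) unfolding assms(5)[symmetric] pairwise_def disjnt_def by blast
  moreover have "closedin Y (\<Union>(\<C> - {C}))"
    using assms(1,2) by (intro closedin_Union) auto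
  ultimately have "openin Y C"
    using assms(5) C(1) by (metis Union_upper openin_closedin_eq)
  then have "F \<subseteq> C"
    using connectedin_clopen_cases[OF connectedin_connected_components_of[OF F] assms(2)[OF C(1)]]
      x C(2) by (auto simp: disjnt_iff)
  moreover have "C \<subseteq> F"
    using connected_components_of_maximal[OF F assms(3)[OF C(1)]] x C(2) by (auto simp: disjnt_iff)
  ultimately show "F \<in> \<C>" using C(1) by simp
qed

lemma open_rectangle_homeomorphic_disc:
  fixes a b c d :: real
  assumes "a < b" "c < d"
  shows "top_of_set (box (a, c) (b, d)) homeomorphic_space top_of_set (ball (0::complex) 1)"
proof -
  have "((a + b) / 2, (c + d) / 2) \<in> box (a, c) (b, d)"
    using assms by (simp add: mem_box Basis_prod_def inner_prod_def)
  then have "box (a, c) (b, d) homeomorphic (UNIV :: (real \<times> real) set)"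
    by (intro homeomorphic_box_UNIV) blast
  also have "(UNIV :: (real \<times> real) set) homeomorphic (UNIV :: complex set)"
    by (simp add: homeomorphic_UNIV_UNIV)
  also have "(UNIV :: complex set) homeomorphic ball (0::complex) 1"
    using homeomorphic_ball01_UNIV homeomorphic_sym by blast
  finally obtain f g where "homeomorphism (box (a, c) (b, d)) (ball (0::complex) 1) f g"
    unfolding homeomorphic_def by blast
  then have "homeomorphic_maps (top_of_set (box (a, c) (b, d))) (top_of_set (ball 0 1)) f g"
    by (auto simp: homeomorphism_def homeomorphic_maps_def)
  then show ?thesis unfolding homeomorphic_space_def by blast
qed

text \<open>Edges are addressed by their starting vertex and their kind, since the arcs of a drawing depend on
  this data and not only on the set of endpoints.\<close>
definition prism_edge :: "nat \<Rightarrow> bool \<times> nat \<Rightarrow> nat set" where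
  "prism_edge k = (\<lambda>(fibre, w). {w, if fibre then up w else turn k w})"

lemma edges_prism_edge: "edges (twisted_prism k) = prism_edge k ` (UNIV \<times> {..<5 * k})"
proof -
  have "f ` (UNIV \<times> A) = (\<lambda>w. f (True, w)) ` A \<union> (\<lambda>w. f (False, w)) ` A"
    for f :: "bool \<times> nat \<Rightarrow> nat set" and A
  proof (intro equalityI subsetI)
    fix x assume "x \<in> f ` (UNIV \<times> A)"
    then obtain b w where "x = f (b, w)" "w \<in> A" by blast
    then show "x \<in> (\<lambda>w. f (True, w)) ` A \<union> (\<lambda>w. f (False, w)) ` A" by (cases b) auto
  qed auto
  then show ?thesis unfolding twisted_prism_def prism_edge_def by simp
qed

lemma inj_on_prism_edge:
  assumes "3 \<le> k"
  shows "inj_on (prism_edge k) (UNIV \<times> {..<5 * k})"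
proof -
  have up2: "up (up w) \<noteq> w" for w
  proof -
    have "up v mod 5 = (v + 1) mod 5" for v by (simp add: up_def mod_simps)
    from this[of w] this[of "up w"] have "up (up w) mod 5 = (w + 2) mod 5"
      by (metis mod_add_left_eq add.assoc one_add_one)
    moreover have "(w + 2) mod 5 \<noteq> w mod 5" by presburger
    ultimately show ?thesis by metis
  qed
  have slice: "w div 5 < k" if "w < 5 * k" for w
    using that less_mult_imp_div_less[of w k 5] by (simp add: mult.commute)
  have step: "turn k w div 5 = (if w div 5 + 1 = k then 0 else w div 5 + 1)" if "w < 5 * k" for w
    using turn_div[OF that] slice[OF that] by auto
  have turn1: "turn k w div 5 \<noteq> w div 5" if "w < 5 * k" for w
    using step[OF that] assms by auto
  have turn2: "turn k (turn k w) \<noteq> w" if "w < 5 * k" for w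
  proof -
    have "turn k w < 5 * k" using turn_less assms by simp
    then have "turn k (turn k w) div 5 \<noteq> w div 5"
      using step[OF that] step[of "turn k w"] slice[OF that] assms by (auto split: if_splits)
    then show ?thesis by metis
  qed
  have upup: "w = x" if "{w, up w} = {x, up x}" for w x
    using that up2[of x] by (auto simp: doubleton_eq_iff)
  have turnturn: "w = x" if "w < 5 * k" "x < 5 * k" "{w, turn k w} = {x, turn k x}" for w x
    using that turn2[of x] by (auto simp: doubleton_eq_iff)
  have mixed: "{w, up w} \<noteq> {x, turn k x}" if "x < 5 * k" for w x
  proof
    assume "{w, up w} = {x, turn k x}"
    then have "turn k x div 5 = x div 5" by (metis doubleton_eq_iff up_div)
    then show False using turn1[OF that] by simp
  qed
  show ?thesis
  proof (rule inj_onI)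
    fix i j assume ij: "i \<in> UNIV \<times> {..<5 * k}" "j \<in> UNIV \<times> {..<5 * k}" "prism_edge k i = prism_edge k j"
    obtain a w b x where eq: "i = (a, w)" "j = (b, x)" by (metis prod.exhaust)
    show "i = j"
      using ij upup[of w x] turnturn[of w x] mixed[of x w] mixed[of w x] unfolding eq
      by (cases a; cases b) (auto simp: prism_edge_def)
  qed
qed

lemma floor_frac_unique:
  fixes s t :: real and i j :: nat
  assumes "real i + s = real j + t" "0 \<le> s" "s < 1" "0 \<le> t" "t < 1"
  shows "i = j \<and> s = t"
proof -
  have "i = j" using assms by linarith
  then show ?thesis using assms(1) by simp
qed

text \<open>The last clause lets grid lines go to grid lines when a point of the plane is moved into the
  fundamental rectangle.\<close>
lemma reduce_mod:
  fixes u :: real and k :: nat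
  assumes "0 < k"
  shows "\<exists>n i s. u = real_of_int n * real k + (real i + s) \<and> i < k \<and> 0 \<le> s \<and> s < 1 \<and>
    (u \<in> \<int> \<longrightarrow> s = 0)"
proof (rule exI[of _ "\<lfloor>u\<rfloor> div k"], rule exI[of _ "nat (\<lfloor>u\<rfloor> mod k)"],
    rule exI[of _ "frac u"], intro conjI impI)
  have "\<lfloor>u\<rfloor> = (\<lfloor>u\<rfloor> div k) * k + \<lfloor>u\<rfloor> mod k" by simp
  then have "real_of_int \<lfloor>u\<rfloor> = real_of_int (\<lfloor>u\<rfloor> div k) * k + real_of_int (\<lfloor>u\<rfloor> mod k)"
    by (metis of_int_add of_int_mult of_int_of_nat_eq)
  then show "u = real_of_int (\<lfloor>u\<rfloor> div k) * k + (real (nat (\<lfloor>u\<rfloor> mod k)) + frac u)"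
    using assms by (simp add: frac_def)
  show "nat (\<lfloor>u\<rfloor> mod k) < k" using assms by (simp add: nat_less_iff)
  show "0 \<le> frac u" "frac u < 1" by (simp_all add: frac_lt_1)
  show "frac u = 0" if "u \<in> \<int>" using that by (rule frac_eq_0_iff[THEN iffD2])
qed

text \<open>The function \<open>\<Phi>\<close> plays the role of the universal covering of the Klein bottle, in coordinates in which
  the lifted graph is the integer grid. It is enough that \<open>\<Phi>\<close> is injective on rectangles smaller than
  \<open>k\<close> by \<open>5\<close>: then vertices, open edges and open unit squares of the fundamental rectangle have disjoint
  images. An open unit square maps homeomorphically because its closure is compact and
  \<open>X\<close> is Hausdorff, and for the same reason its image is closed in the complement of the drawing, so
  that it is a face.\<close>
lemma embeddable_by_grid:
  fixes \<Phi> :: "real \<times> real \<Rightarrow> 'b"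
  assumes k: "3 \<le> k" and haus: "Hausdorff_space X"
    and cont: "continuous_map euclidean X \<Phi>" and onto: "range \<Phi> = topspace X"
    and per1: "\<And>u v. \<Phi> (u, v + 5) = \<Phi> (u, v)" and per2: "\<And>u v. \<Phi> (u + real k, v) = \<Phi> (u, - v)"
    and inj: "\<And>u v u' v'. \<Phi> (u, v) = \<Phi> (u', v') \<Longrightarrow> \<bar>u - u'\<bar> < real k \<Longrightarrow> \<bar>v - v'\<bar> < 5 \<Longrightarrow>
      u = u' \<and> v = v'"
  shows "embeddable_in (twisted_prism k) X"
proof -
  define I where "I = (UNIV :: bool set) \<times> {..<5 * k}"
  \<comment> \<open>\<open>Q w s t\<close> runs through the unit square of the grid with lower left corner \<open>w\<close>.
    With \<open>s, t \<in> [0, 1)\<close> these squares tile the fundamental rectangle.\<close>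
  define Q where "Q w s t = \<Phi> (real (w div 5) + s, real (w mod 5) + t)" for w s t
  define p where "p w = Q w 0 0" for w
  define arc where "arc = (\<lambda>(fibre, w) t. if fibre then Q w 0 t else Q w t 0)"
  define \<gamma> where "\<gamma> e = arc (inv_into I (prism_edge k) e)" for e
  have slice: "w div 5 < k" if "w < 5 * k" for w
    using that less_mult_imp_div_less[of w k 5] by (simp add: mult.commute)
  have edges: "edges (twisted_prism k) = prism_edge k ` I"
    unfolding I_def by (rule edges_prism_edge)
  have \<gamma>: "\<gamma> (prism_edge k i) = arc i" if "i \<in> I" for i
    using inj_on_prism_edge[OF k] that unfolding \<gamma>_def I_def by simp

  have Q_inj: "w = w' \<and> s = s' \<and> t = t'"
    if "Q w s t = Q w' s' t'" "w < 5 * k" "w' < 5 * k"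
      and st: "0 \<le> s" "s < 1" "0 \<le> t" "t < 1" "0 \<le> s'" "s' < 1" "0 \<le> t'" "t' < 1" for w w' s s' t t'
  proof -
    have "real (w div 5) + 1 \<le> k" "real (w' div 5) + 1 \<le> k"
      using slice[OF that(2)] slice[OF that(3)] by linarith+
    moreover have "real (w mod 5) \<le> 4" "real (w' mod 5) \<le> 4"
      using mod_less_divisor[of 5 w] mod_less_divisor[of 5 w'] by linarith+
    ultimately have "real (w div 5) + s = real (w' div 5) + s' \<and> real (w mod 5) + t = real (w' mod 5) + t'"
      using st by (intro inj that(1)[unfolded Q_def]) linarith+
    then have "w div 5 = w' div 5 \<and> s = s'" "w mod 5 = w' mod 5 \<and> t = t'"
      using floor_frac_unique st by blast+
    then show ?thesis by (metis div_mult_mod_eq)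
  qed
  have per1': "\<Phi> (u, v + of_int n * 5) = \<Phi> (u, v)" for u v n
  proof (induction n rule: int_induct[where k = 0])
    case (step1 i)
    then show ?case using per1[of u "v + of_int i * 5"] by (simp add: algebra_simps)
  next
    case (step2 i)
    then show ?case using per1[of u "v + of_int (i - 1) * 5"] by (simp add: algebra_simps)
  qed simp
  have per2': "\<exists>v'\<in>{v, - v}. \<Phi> (u + of_int n * real k, v) = \<Phi> (u, v')" for u v n
  proof (induction n arbitrary: v rule: int_induct[where k = 0])
    case (step1 i)
    then show ?case using per2[of "u + of_int i * real k" v] step1.IH[of "- v"] by (auto simp: algebra_simps)
  next
    case (step2 i)
    then show ?case using per2[of "u + of_int (i - 1) * real k" "- v"] step2.IH[of "- v"] by (auto simp: algebra_simps)
  qed simp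
  have Q_onto: "\<exists>w s t. \<Phi> (u, v) = Q w s t \<and> w < 5 * k \<and> 0 \<le> s \<and> s < 1 \<and> 0 \<le> t \<and> t < 1 \<and>
      (u \<in> \<int> \<longrightarrow> s = 0) \<and> (v \<in> \<int> \<longrightarrow> t = 0)" for u v
  proof -
    have "0 < k" using k by simp
    then obtain n i s where u: "u = real_of_int n * k + (real i + s)" "i < k" "0 \<le> s" "s < 1" "u \<in> \<int> \<longrightarrow> s = 0"
      using reduce_mod[of k u] by blast
    obtain v' where v': "v' \<in> {v, - v}" "\<Phi> (u, v) = \<Phi> (real i + s, v')"
      using per2'[where u = "real i + s" and n = n and v = v] unfolding u(1) by (metis add.commute)
    have "0 < (5 :: nat)" by simp
    then obtain m j t where v: "v' = real_of_int m * real 5 + (real j + t)" "j < 5" "0 \<le> t" "t < 1" "v' \<in> \<int> \<longrightarrow> t = 0"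
      using reduce_mod[of 5 v'] by blast
    have "\<Phi> (u, v) = Q (5 * i + j) s t"
    proof -
      have "v' = real j + t + of_int m * 5" using v(1) by simp
      then have "\<Phi> (u, v) = \<Phi> (real i + s, real j + t)"
        using per1'[where u = "real i + s" and v = "real j + t" and n = m] v'(2) by simp
      then show ?thesis using v(2) by (simp add: Q_def)
    qed
    moreover have "5 * i + j < 5 * k" using u(2) v(2) by linarith
    moreover have "t = 0" if "v \<in> \<int>" using v'(1) v(5) that by auto
    ultimately show ?thesis using u(3-5) v(3,4) by blast
  qed

  have p_up: "Q w 0 1 = p (up w)" for w
  proof (cases "w mod 5 = 4")
    case True
    then show ?thesis using per1[of "real (w div 5)" 0] by (simp add: p_def Q_def up_mod mod_Suc)
  next
    case False
    then have "up w mod 5 = w mod 5 + 1" by (simp add: up_mod mod_Suc)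
    then show ?thesis by (simp add: p_def Q_def add.commute)
  qed
  have p_turn: "Q w 1 0 = p (turn k w)" if w: "w < 5 * k" for w
  proof (cases "w + 5 < 5 * k")
    case True
    then show ?thesis by (simp add: p_def Q_def turn_def add.commute)
  next
    case False
    then have "w div 5 + 1 = k"
      using before_last_slice[of w k] slice[OF w] by linarith
    then have "Q w 1 0 = \<Phi> (0 + real k, real (w mod 5))"
      by (metis Q_def add.left_neutral add.right_neutral of_nat_1 of_nat_add)
    also have "\<dots> = \<Phi> (0, - real (w mod 5))" by (rule per2)
    also have "\<dots> = p (turn k w)"
    proof (cases "w mod 5 = 0")
      case True
      then show ?thesis using False by (simp add: p_def Q_def turn_def)
    next
      case nz: False
      then have "turn k w = 5 - w mod 5" using False by (simp add: turn_def)
      moreover have "w mod 5 < 5" by simp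
      ultimately have "turn k w div 5 = 0" "real (turn k w mod 5) = - real (w mod 5) + 5"
        using nz by auto
      then show ?thesis using per1[of 0 "- real (w mod 5)"] by (simp add: p_def Q_def)
    qed
    finally show ?thesis .
  qed
  have turn_lt: "turn k w < 5 * k" for w using turn_less k by simp
  have arc_ends: "{arc i 0, arc i 1} = p ` prism_edge k i" if "i \<in> I" for i
    using that p_up p_turn by (cases i) (auto simp: arc_def prism_edge_def I_def p_def)
  have prism_edge_verts: "prism_edge k i \<subseteq> {..<5 * k}" if "i \<in> I" for i
    using that up_less turn_lt by (cases i) (auto simp: prism_edge_def I_def)

  have drawing: "drawing X (twisted_prism k) p \<gamma>"
    unfolding drawing_def edges verts_twisted_prism
  proof (intro conjI ballI impI)
    show "p ` {..<5 * k} \<subseteq> topspace X" using onto by (auto simp: p_def Q_def)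
    show "inj_on p {..<5 * k}"
      by (rule inj_onI) (use Q_inj[where s = 0 and t = 0 and s' = 0 and t' = 0] in \<open>auto simp: p_def\<close>)
  next
    fix e assume "e \<in> prism_edge k ` I"
    then obtain b w where i: "(b, w) \<in> I" "e = prism_edge k (b, w)" by auto
    then have w: "w < 5 * k" and \<gamma>e: "\<gamma> e = arc (b, w)" using \<gamma> by (auto simp: I_def)
    define seg where "seg t = (if b then (real (w div 5) + 0, real (w mod 5) + t)
      else (real (w div 5) + t, real (w mod 5) + 0))" for t
    have "continuous_on UNIV seg"
      unfolding seg_def by (cases b) (auto intro!: continuous_intros)
    then have "continuous_map euclidean X (\<Phi> \<circ> seg)"
      using cont by (intro continuous_map_compose) auto
    then have "continuous_map (top_of_set {0..1}) X (arc (b, w))"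
      by (intro continuous_map_from_subtopology)
        (simp add: comp_def seg_def arc_def Q_def if_distrib[of \<Phi>] cong: if_cong)
    then show "pathin X (\<gamma> e)" by (simp add: pathin_def \<gamma>e)
    show "inj_on (\<gamma> e) {0..1}"
    proof (rule inj_onI)
      fix s t :: real assume st: "s \<in> {0..1}" "t \<in> {0..1}" "\<gamma> e s = \<gamma> e t"
      have "\<bar>s - t\<bar> \<le> 1" using st by auto
      then show "s = t"
        using st(3) inj[of "real (w div 5)" "real (w mod 5) + s" "real (w div 5)" "real (w mod 5) + t"]
          inj[of "real (w div 5) + s" "real (w mod 5)" "real (w div 5) + t" "real (w mod 5)"] k
        by (cases b) (auto simp: \<gamma>e arc_def Q_def)
    qed
    show "{\<gamma> e 0, \<gamma> e 1} = p ` e" using arc_ends[OF i(1)] unfolding \<gamma>e unfolding i(2) .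
    show "\<gamma> e ` {0<..<1} \<inter> p ` {..<5 * k} = {}"
    proof -
      have "arc (b, w) t \<noteq> p w'" if "0 < t" "t < 1" "w' < 5 * k" for t w'
        using that w Q_inj[of w 0 t w' 0 0] Q_inj[of w t 0 w' 0 0] by (cases b) (auto simp: arc_def p_def)
      then show ?thesis by (auto simp: \<gamma>e)
    qed
    fix f assume "f \<in> prism_edge k ` I" and ef: "e \<noteq> f"
    then obtain b' w' where j: "(b', w') \<in> I" "f = prism_edge k (b', w')" by auto
    then have w': "w' < 5 * k" and \<gamma>f: "\<gamma> f = arc (b', w')" using \<gamma> by (auto simp: I_def)
    have "arc (b, w) s \<noteq> arc (b', w') t" if "0 < s" "s < 1" "0 < t" "t < 1" for s t
    proof
      assume "arc (b, w) s = arc (b', w') t"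
      then have "b = b' \<and> w = w'"
        using that w w' Q_inj[of w 0 s w' 0 t] Q_inj[of w 0 s w' t 0] Q_inj[of w s 0 w' 0 t]
          Q_inj[of w s 0 w' t 0] by (cases b; cases b') (auto simp: arc_def)
      then show False using ef i(2) j(2) by simp
    qed
    then show "\<gamma> e ` {0<..<1} \<inter> \<gamma> f ` {0<..<1} = {}" by (auto simp: \<gamma>e \<gamma>f)
  qed

  define D where "D = drawing_image (twisted_prism k) p \<gamma>"
  have D_arcs: "D = p ` {..<5 * k} \<union> (\<Union>i\<in>I. arc i ` {0..1})"
    using \<gamma> by (simp add: D_def drawing_image_def edges)
  have Q_D: "Q w s t \<in> D \<longleftrightarrow> s = 0 \<or> t = 0"
    if "w < 5 * k" "0 \<le> s" "s < 1" "0 \<le> t" "t < 1" for w s t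
  proof
    assume "Q w s t \<in> D"
    then consider w' where "w' < 5 * k" "Q w s t = p w'"
      | b w' r where "w' < 5 * k" "0 \<le> r" "r \<le> 1" "Q w s t = arc (b, w') r"
      unfolding D_arcs I_def by auto
    then show "s = 0 \<or> t = 0"
    proof cases
      case 1
      then show ?thesis using that Q_inj[of w s t w' 0 0] by (simp add: p_def)
    next
      case 2
      show ?thesis
      proof (cases "r = 1")
        case True
        have "(b, w') \<in> I" using 2 by (simp add: I_def)
        then have "arc (b, w') 1 \<in> p ` {..<5 * k}" using arc_ends prism_edge_verts by blast
        then obtain x where "x < 5 * k" "Q w s t = p x" using 2(4) True by auto
        then show ?thesis using that Q_inj[of w s t x 0 0] by (simp add: p_def)
      next
        case False
        then show ?thesis
          using that 2 Q_inj[of w s t w' 0 r] Q_inj[of w s t w' r 0] by (cases b) (auto simp: arc_def)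
      qed
    qed
  next
    assume "s = 0 \<or> t = 0"
    then have "Q w s t = arc (True, w) t \<or> Q w s t = arc (False, w) s" by (auto simp: arc_def)
    moreover have "(True, w) \<in> I" "(False, w) \<in> I" using that by (auto simp: I_def)
    moreover have "s \<in> {0..1}" "t \<in> {0..1}" using that by auto
    ultimately show "Q w s t \<in> D" unfolding D_arcs by blast
  qed
  \<comment> \<open>The whole grid lies in the drawing, also outside of the fundamental rectangle; hence
    so do the right and upper sides of its squares.\<close>
  have line_D: "\<Phi> (u, v) \<in> D" if "u \<in> \<int> \<or> v \<in> \<int>" for u v
    using Q_onto[of u v] Q_D that by metis

  define Y where "Y = subtopology X (topspace X - D)"
  define R where "R w = box (real (w div 5), real (w mod 5)) (real (w div 5) + 1, real (w mod 5) + 1)" for w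
  define C where "C w = cbox (real (w div 5), real (w mod 5)) (real (w div 5) + 1, real (w mod 5) + 1)" for w
  have R_iff: "(u, v) \<in> R w \<longleftrightarrow>
      (\<exists>s t. u = real (w div 5) + s \<and> v = real (w mod 5) + t \<and> 0 < s \<and> s < 1 \<and> 0 < t \<and> t < 1)" for u v w
  proof -
    have shift: "(\<exists>s. x = a + s \<and> 0 < s \<and> s < 1) \<longleftrightarrow> a < x \<and> x < a + 1" for x a :: real
      by (auto intro!: exI[of _ "x - a"])
    have "(u, v) \<in> R w \<longleftrightarrow> (real (w div 5) < u \<and> u < real (w div 5) + 1) \<and>
        real (w mod 5) < v \<and> v < real (w mod 5) + 1"
      by (auto simp: R_def mem_box Basis_prod_def inner_prod_def)
    then show ?thesis unfolding shift[symmetric] by blast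
  qed
  have C_iff: "(u, v) \<in> C w \<longleftrightarrow>
      (\<exists>s t. u = real (w div 5) + s \<and> v = real (w mod 5) + t \<and> 0 \<le> s \<and> s \<le> 1 \<and> 0 \<le> t \<and> t \<le> 1)" for u v w
  proof -
    have shift: "(\<exists>s. x = a + s \<and> 0 \<le> s \<and> s \<le> 1) \<longleftrightarrow> a \<le> x \<and> x \<le> a + 1" for x a :: real
      by (auto intro!: exI[of _ "x - a"])
    have "(u, v) \<in> C w \<longleftrightarrow> (real (w div 5) \<le> u \<and> u \<le> real (w div 5) + 1) \<and>
        real (w mod 5) \<le> v \<and> v \<le> real (w mod 5) + 1"
      by (auto simp: C_def)
    then show ?thesis unfolding shift[symmetric] by blast
  qed
  have R_C: "R w \<subseteq> C w" for w unfolding R_def C_def by (rule box_subset_cbox)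
  have \<Phi>_R: "\<Phi> ` R w = {Q w s t | s t. 0 < s \<and> s < 1 \<and> 0 < t \<and> t < 1}" for w
    by (auto simp: R_iff Q_def image_iff) (metis R_iff)
  have topY: "topspace Y = topspace X - D" by (auto simp: Y_def)
  have R_Y: "\<Phi> ` R w \<subseteq> topspace X - D" if "w < 5 * k" for w
  proof
    fix x assume "x \<in> \<Phi> ` R w"
    then obtain s t where "x = Q w s t" "0 < s" "s < 1" "0 < t" "t < 1" unfolding \<Phi>_R by blast
    then show "x \<in> topspace X - D" using Q_D[OF that, of s t] onto by (auto simp: Q_def)
  qed
  have C_Y: "\<Phi> ` C w \<inter> (topspace X - D) = \<Phi> ` R w" if "w < 5 * k" for w
  proof
    show "\<Phi> ` C w \<inter> (topspace X - D) \<subseteq> \<Phi> ` R w"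
    proof
      fix x assume x: "x \<in> \<Phi> ` C w \<inter> (topspace X - D)"
      then obtain u v where uv: "x = \<Phi> (u, v)" "(u, v) \<in> C w" by auto
      then obtain s t where st: "u = real (w div 5) + s" "v = real (w mod 5) + t" "0 \<le> s" "s \<le> 1" "0 \<le> t" "t \<le> 1"
        unfolding C_iff by blast
      have "u \<notin> \<int>" "v \<notin> \<int>" using line_D[of u v] x uv by auto
      then have "s \<noteq> 0" "s \<noteq> 1" "t \<noteq> 0" "t \<noteq> 1" using st(1,2) by auto
      then have "(u, v) \<in> R w" unfolding R_iff using st by (intro exI[of _ s] exI[of _ t]) auto
      then show "x \<in> \<Phi> ` R w" using uv(1) by blast
    qed
  qed (use R_C R_Y[OF that] in blast)
  have emb: "homeomorphic_map (top_of_set (C w)) (subtopology X (\<Phi> ` C w)) \<Phi>" for w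
  proof -
    have "inj_on \<Phi> (C w)"
    proof (rule inj_onI)
      fix a b assume ab: "a \<in> C w" "b \<in> C w" "\<Phi> a = \<Phi> b"
      obtain u v u' v' where eq: "a = (u, v)" "b = (u', v')" by (metis prod.exhaust)
      have "\<bar>u - u'\<bar> \<le> 1" "\<bar>v - v'\<bar> \<le> 1" using ab(1,2) unfolding eq C_iff by auto
      then show "a = b" using inj[of u v u' v'] ab(3) k unfolding eq by auto
    qed
    moreover have "compact_space (top_of_set (C w))"
      by (simp add: C_def compact_space_subtopology compact_cbox)
    ultimately have "embedding_map (top_of_set (C w)) X \<Phi>"
      using cont haus by (intro continuous_imp_embedding_map continuous_map_from_subtopology) auto
    then show ?thesis by (simp add: embedding_map_def)
  qed
  have embR: "homeomorphic_map (top_of_set (R w)) (subtopology X (\<Phi> ` R w)) \<Phi>" for w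
  proof -
    have "\<Phi> ` C w \<subseteq> topspace X" using onto by auto
    then have "homeomorphic_map (subtopology (top_of_set (C w)) (R w))
        (subtopology (subtopology X (\<Phi> ` C w)) (\<Phi> ` R w)) \<Phi>"
      using R_C[of w] by (intro homeomorphic_map_subtopologies[OF emb]) auto
    moreover have "C w \<inter> R w = R w" "\<Phi> ` C w \<inter> \<Phi> ` R w = \<Phi> ` R w" using R_C[of w] by auto
    ultimately show ?thesis by (simp add: subtopology_subtopology)
  qed

  have "connected_components_of Y \<subseteq> (\<lambda>w. \<Phi> ` R w) ` {..<5 * k}"
  proof (rule components_of_closed_partition)
    fix F assume "F \<in> (\<lambda>w. \<Phi> ` R w) ` {..<5 * k}"
    then obtain w where w: "w < 5 * k" "F = \<Phi> ` R w" by auto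
    have "compactin X (\<Phi> ` C w)"
      using image_compactin[OF _ cont, of "C w"] by (simp add: C_def compact_cbox)
    then have "closedin X (\<Phi> ` C w)" using haus by (rule compactin_imp_closedin[rotated])
    then show "closedin Y F"
      unfolding Y_def closedin_subtopology using C_Y[OF w(1)] w(2)
      by (intro exI[of _ "\<Phi> ` C w"]) simp
    have "connectedin X (\<Phi> ` R w)"
      using connectedin_continuous_map_image[OF cont, of "R w"]
      by (simp add: R_def convex_connected[OF convex_box(2)])
    then show "connectedin Y F"
      using R_Y[OF w(1)] w(2) by (simp add: Y_def connectedin_subtopology)
  next
    show "pairwise disjnt ((\<lambda>w. \<Phi> ` R w) ` {..<5 * k})"
    proof (rule pairwiseI)
      fix F F' assume "F \<in> (\<lambda>w. \<Phi> ` R w) ` {..<5 * k}" "F' \<in> (\<lambda>w. \<Phi> ` R w) ` {..<5 * k}" "F \<noteq> F'"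
      then obtain w w' where w: "w < 5 * k" "w' < 5 * k" "F = \<Phi> ` R w" "F' = \<Phi> ` R w'" "w \<noteq> w'" by auto
      then show "disjnt F F'" using Q_inj[of w _ _ w'] unfolding \<Phi>_R disjnt_iff by force
    qed
    show "\<Union>((\<lambda>w. \<Phi> ` R w) ` {..<5 * k}) = topspace Y"
    proof
      show "topspace Y \<subseteq> \<Union>((\<lambda>w. \<Phi> ` R w) ` {..<5 * k})"
      proof
        fix x assume x: "x \<in> topspace Y"
        then obtain u v where "x = \<Phi> (u, v)" using onto topY by (metis DiffD1 imageE prod.exhaust)
        then obtain w s t where "x = Q w s t" "w < 5 * k" "0 \<le> s" "s < 1" "0 \<le> t" "t < 1"
          using Q_onto[of u v] by auto
        moreover from this have "s \<noteq> 0" "t \<noteq> 0" using Q_D[of w s t] x topY by auto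
        ultimately have "x \<in> \<Phi> ` R w" unfolding \<Phi>_R by force
        then show "x \<in> \<Union>((\<lambda>w. \<Phi> ` R w) ` {..<5 * k})" using \<open>w < 5 * k\<close> by auto
      qed
    qed (use R_Y topY in auto)
  qed simp
  moreover have "subtopology X (\<Phi> ` R w) homeomorphic_space top_of_set (ball (0::complex) 1)" for w
  proof -
    have "subtopology X (\<Phi> ` R w) homeomorphic_space top_of_set (R w)"
      using embR homeomorphic_space_sym homeomorphic_map_imp_homeomorphic_space by blast
    also have "top_of_set (R w) homeomorphic_space top_of_set (ball (0::complex) 1)"
      unfolding R_def by (rule open_rectangle_homeomorphic_disc) auto
    finally show ?thesis .
  qed
  ultimately have "cellular_embedding X (twisted_prism k) p \<gamma>"
    using drawing unfolding cellular_embedding_def faces_def D_def[symmetric] Y_def[symmetric] by blast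
  then show ?thesis unfolding embeddable_in_def by blast
qed

lemma twisted_prism_embeddable_klein_bottle:
  assumes k: "3 \<le> k"
  shows "embeddable_in (twisted_prism k) klein_bottle"
proof -
  obtain h where h: "homeomorphic_map (top_of_set klein_surface) klein_bottle h"
    by (rule klein_bottle_homeomorphic)
  define \<kappa> where "\<kappa> = (\<lambda>(u, v). klein_point (pi * u / real k) (2 * pi * v / 5))"
  define \<Phi> where "\<Phi> p = h (\<kappa> p)" for p
  have \<kappa>_surface: "\<kappa> p \<in> klein_surface" for p
    by (cases p) (auto simp: \<kappa>_def klein_surface_def)
  have h_inj: "inj_on h klein_surface" and h_onto: "h ` klein_surface = topspace klein_bottle"
    using h homeomorphic_imp_injective_map[OF h] homeomorphic_imp_surjective_map[OF h] by simp_all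
  show ?thesis
  proof (rule embeddable_by_grid[OF k])
    show "Hausdorff_space klein_bottle"
      using homeomorphic_Hausdorff_space[OF homeomorphic_map_imp_homeomorphic_space[OF h]]
      by (simp add: Hausdorff_space_subtopology)
    have "continuous_on UNIV ((\<lambda>p. klein_point (fst p) (snd p)) \<circ> (\<lambda>(u, v). (pi * u / real k, 2 * pi * v / 5)))"
      unfolding case_prod_beta
      by (intro continuous_on_compose continuous_on_klein_point continuous_intros) (use k in auto)
    then have "continuous_on UNIV \<kappa>" by (simp add: \<kappa>_def comp_def case_prod_beta)
    then have "continuous_map euclidean (top_of_set klein_surface) \<kappa>"
      using \<kappa>_surface by (simp add: continuous_map_in_subtopology image_subset_iff)
    then have "continuous_map euclidean klein_bottle (h \<circ> \<kappa>)"
      using homeomorphic_imp_continuous_map[OF h] by (rule continuous_map_compose)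
    moreover have "\<Phi> = h \<circ> \<kappa>" by (rule ext) (simp add: \<Phi>_def)
    ultimately show "continuous_map euclidean klein_bottle \<Phi>" by (simp only:)
    have "klein_surface \<subseteq> range \<kappa>"
    proof
      fix q assume "q \<in> klein_surface"
      then obtain x y where "q = klein_point x y" by (auto simp: klein_surface_def)
      then have "q = \<kappa> (real k * x / pi, 5 * y / (2 * pi))" using k by (simp add: \<kappa>_def)
      then show "q \<in> range \<kappa>" by blast
    qed
    then have "range \<kappa> = klein_surface" using \<kappa>_surface by blast
    then have "h ` range \<kappa> = topspace klein_bottle" by (simp only: h_onto)
    then show "range \<Phi> = topspace klein_bottle" unfolding \<Phi>_def image_image .
  next
    fix u v
    have "2 * pi * (v + 5) / 5 = 2 * pi * v / 5 + 2 * pi" by (simp add: field_simps)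
    then show "\<Phi> (u, v + 5) = \<Phi> (u, v)" by (simp only: \<Phi>_def \<kappa>_def prod.case klein_point_shift(2))
    have "pi * (u + real k) / real k = pi * u / real k + pi" using k by (simp add: field_simps)
    moreover have "2 * pi * - v / 5 = - (2 * pi * v / 5)" by simp
    ultimately show "\<Phi> (u + real k, v) = \<Phi> (u, - v)"
      by (simp only: \<Phi>_def \<kappa>_def prod.case klein_point_shift(1))
  next
    fix u v u' v'
    assume eq: "\<Phi> (u, v) = \<Phi> (u', v')" and u: "\<bar>u - u'\<bar> < real k" and v: "\<bar>v - v'\<bar> < 5"
    have "\<kappa> (u, v) = \<kappa> (u', v')"
      using eq h_inj \<kappa>_surface unfolding \<Phi>_def by (auto dest: inj_onD)
    moreover have "\<bar>pi * u / real k - pi * u' / real k\<bar> < pi"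
    proof -
      have "pi * u / real k - pi * u' / real k = pi * ((u - u') / real k)"
        by (simp add: algebra_simps diff_divide_distrib)
      moreover have "0 < real k" using k by simp
      ultimately show ?thesis using u by (simp add: abs_mult pos_divide_less_eq)
    qed
    moreover have "\<bar>2 * pi * v / 5 - 2 * pi * v' / 5\<bar> < 2 * pi"
    proof -
      have "2 * pi * v / 5 - 2 * pi * v' / 5 = 2 * pi * ((v - v') / 5)"
        by (simp add: algebra_simps diff_divide_distrib)
      then have "\<bar>2 * pi * v / 5 - 2 * pi * v' / 5\<bar> = 2 * pi * (\<bar>v - v'\<bar> / 5)"
        by (simp only: abs_mult abs_divide) simp
      also have "\<dots> < 2 * pi * 1" using v by (intro mult_strict_left_mono) simp_all
      finally show ?thesis by simp
    qed
    ultimately have "pi * u / real k = pi * u' / real k \<and> 2 * pi * v / 5 = 2 * pi * v' / 5"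
      by (intro klein_point_inj) (simp_all add: \<kappa>_def)
    then show "u = u' \<and> v = v'" using k by simp
  qed
qed

section \<open>Infinitely many 3-extendable graphs on the Klein bottle\<close>

theorem mainTheorem3:
  shows "\<exists>\<G> :: nat graph set. infinite \<G> \<and>
           (\<forall>G\<in>\<G>. finite_simple_graph G \<and> k_extendable 3 G \<and> \<not> bipartite G \<and>
                    embeddable_in G klein_bottle) \<and>
           (\<forall>G\<in>\<G>. \<forall>H\<in>\<G>. G \<noteq> H \<longrightarrow> \<not> graph_isomorphic G H)"
proof (intro exI conjI ballI impI)
  let ?\<G> = "range (\<lambda>n. twisted_prism (8 + 2 * n))"
  have card: "card (verts (twisted_prism k)) = 5 * k" for k by simp
  have "inj (\<lambda>n. twisted_prism (8 + 2 * n))"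
  proof (rule injI)
    fix m n assume "twisted_prism (8 + 2 * m) = twisted_prism (8 + 2 * n)"
    then have "5 * (8 + 2 * m) = 5 * (8 + 2 * n)" using card by metis
    then show "m = n" by simp
  qed
  then show "infinite ?\<G>" by (rule range_inj_infinite)
  fix G assume "G \<in> ?\<G>"
  then obtain n where G: "G = twisted_prism (8 + 2 * n)" by blast
  show "finite_simple_graph G" unfolding G by (rule finite_simple_graph_twisted_prism) simp
  show "k_extendable 3 G"
    unfolding k_extendable_def G card
    using twisted_prism_extends_3_matching[of n] perfect_matching_twisted_prism[of "8 + 2 * n"]
    by (simp add: extends_to_perfect_def)
  show "\<not> bipartite G" unfolding G by (rule not_bipartite_twisted_prism) simp
  show "embeddable_in G klein_bottle"
    unfolding G by (rule twisted_prism_embeddable_klein_bottle) simp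
  fix H assume "H \<in> ?\<G>" and "G \<noteq> H"
  then obtain m where H: "H = twisted_prism (8 + 2 * m)" by blast
  show "\<not> graph_isomorphic G H"
  proof
    assume "graph_isomorphic G H"
    then have "card (verts G) = card (verts H)"
      by (auto simp: graph_isomorphic_def bij_betw_same_card)
    then have "n = m" unfolding G H card by simp
    then show False using \<open>G \<noteq> H\<close> G H by simp
  qed
qed

end
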